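(* Let $X:=C_0(\mathbb{R})$ or $X:=C_b(\mathbb{R})$. Let $w:\mathbb{R}\to\mathbb{R}$ be a uniformly continuous function that satisfies $$0<\inf_{x\in\mathbb{R}}|w(x)|\le\sup_{x\in\mathbb{R}}|w(x)|<\infty.$$ Then the bilateral weighted translation operator $T_w:X\to X$, $T_w(\varphi)=\varphi(\cdot+1)\,w(\cdot)$, has the shadowing property if and only if one of the following conditions holds: \begin{itemize} \item[(a)] $\lim_{n\to\infty}\sup_{x\in\mathbb{R}}|w(x)\cdots w(x+n-1)|^{\frac1n}<1$; \item[(b)] $\lim_{n\to\infty}\inf_{x\in\mathbb{R}}|w(x)\cdots w(x+n-1)|^{\frac1n}>1$; \item[(c)] $\lim_{n\to\infty}\sup_{x\in(-\infty,-n+1]}|w(x)\cdots w(x+n-1)|^{\frac1n}<1$ and $\lim_{n\to\infty}\inf_{x\in[n,\infty)}|w(x-n)\cdots w(x-1)|^{\frac1n}>1$. \end{itemize}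
   Context: $\mathbb{K}$ is $\mathbb{R}$ or $\mathbb{C}$. $C_b(\mathbb{R})$ is the Banach space of bounded continuous functions $\mathbb{R}\to\mathbb{K}$ with the supremum norm, and $C_0(\mathbb{R})$ is its closed subspace of functions vanishing at infinity. The product $w(x)\cdots w(x+n-1)$ means $\prod_{j=0}^{n-1}w(x+j)$, and $w(x-n)\cdots w(x-1)$ means $\prod_{j=1}^{n}w(x-j)$. Shadowing: an invertible operator $T$ (continuous invertible linear self-map) on a Banach space $X$ has the shadowing property if for every $\varepsilon>0$ there is $\delta>0$ such that for every sequence $(x_j)_{j\in\mathbb{Z}}$ in $X$ with $\|T(x_j)-x_{j+1}\|\le\delta$ for all $j\in\mathbb{Z}$ there is $x\in X$ with $\|x_j-T^j(x)\|<\varepsilon$ for all $j\in\mathbb{Z}$. *)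

theory Defs
  imports "HOL-Analysis.Analysis"
begin

text \<open>
  The scalar field is a type \<open>'k\<close>, to be instantiated with \<^typ>\<open>real\<close> and \<^typ>\<open>complex\<close>.
  The space of bounded continuous functions is the library type \<^typ>\<open>real \<Rightarrow>\<^sub>C 'k\<close> with its
  supremum norm, and closed subspaces are represented by their carrier sets.
\<close>

definition Cb_R :: "(real \<Rightarrow>\<^sub>C 'k::real_normed_field) set" where
  "Cb_R = UNIV"

definition C0_R :: "(real \<Rightarrow>\<^sub>C 'k::real_normed_field) set" where
  "C0_R = {\<phi>. (apply_bcontfun \<phi> \<longlongrightarrow> 0) at_infinity}"

text \<open>
  The library provides only real scalar multiplication on \<^typ>\<open>real \<Rightarrow>\<^sub>C 'k\<close>; linearity over
  \<open>'k\<close> needs the following one.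
\<close>

definition scale_bcontfun :: "'k \<Rightarrow> (real \<Rightarrow>\<^sub>C 'k) \<Rightarrow> (real \<Rightarrow>\<^sub>C 'k::real_normed_field)" where
  "scale_bcontfun c \<phi> = Bcontfun (\<lambda>x. c * \<phi> x)"

definition invertible_operator_on ::
    "(real \<Rightarrow>\<^sub>C 'k::real_normed_field) set \<Rightarrow> ((real \<Rightarrow>\<^sub>C 'k) \<Rightarrow> (real \<Rightarrow>\<^sub>C 'k)) \<Rightarrow> bool" where
  "invertible_operator_on X T \<longleftrightarrow>
     (\<forall>\<phi>\<in>X. \<forall>\<psi>\<in>X. T (\<phi> + \<psi>) = T \<phi> + T \<psi>) \<and>
     (\<forall>c. \<forall>\<phi>\<in>X. T (scale_bcontfun c \<phi>) = scale_bcontfun c (T \<phi>)) \<and>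
     continuous_on X T \<and>
     bij_betw T X X"

text \<open>
  Integer iterates of a bijection \<open>T\<close> of \<open>X\<close>; the inverse is that of the restriction of
  \<open>T\<close> to \<open>X\<close>.
\<close>

definition int_iterate :: "'v set \<Rightarrow> ('v \<Rightarrow> 'v) \<Rightarrow> int \<Rightarrow> 'v \<Rightarrow> 'v" where
  "int_iterate X T j = (if j \<ge> 0 then T ^^ nat j else inv_into X T ^^ nat (- j))"

definition shadowing_property_on :: "'v::real_normed_vector set \<Rightarrow> ('v \<Rightarrow> 'v) \<Rightarrow> bool" where
  "shadowing_property_on X T \<longleftrightarrow>
     (\<forall>\<epsilon>>0. \<exists>\<delta>>0. \<forall>x :: int \<Rightarrow> 'v.
        (\<forall>j. x j \<in> X) \<and> (\<forall>j. norm (T (x j) - x (j + 1)) \<le> \<delta>) \<longrightarrow>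
        (\<exists>y\<in>X. \<forall>j. norm (x j - int_iterate X T j y) < \<epsilon>))"

text \<open>
  For bounded continuous \<open>w\<close> the argument of \<^const>\<open>Bcontfun\<close> is bounded and continuous, so this
  is the pointwise formula.
\<close>

definition weighted_translation ::
    "(real \<Rightarrow> real) \<Rightarrow> (real \<Rightarrow>\<^sub>C 'k) \<Rightarrow> (real \<Rightarrow>\<^sub>C 'k::real_normed_field)" where
  "weighted_translation w \<phi> = Bcontfun (\<lambda>x. \<phi> (x + 1) * of_real (w x))"

end

theory Submission
  imports Defs
begin

text \<open>
  Along each line \<open>s + \<int>\<close> the operator \<open>T\<^sub>w\<close> is a scalar weighted shift: the values \<open>u j = z j (s - j)\<close> of
  a solution of \<open>z (j + 1) = T\<^sub>w (z j) + e j\<close> satisfy \<open>u (j + 1) = w (s - 1 - j) * u j + e j (s - 1 - j)\<close>.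
  Shadowing is the same as the existence of bounded solutions \<open>z\<close>, with a uniform bound, for all small
  bounded forcings \<open>e\<close> (\<open>shadowing_iff_bounded_solutions\<close>).

  The limits in the three conditions can be replaced by exponential bounds
  \<open>|w x * \<dots> * w (x + n - 1)| \<le> C * r ^ n\<close> with \<open>r < 1\<close>, or by such bounds for the reciprocals. Windows can
  be cut into shorter windows, so Fekete's lemma gives the existence of the limits
  (\<open>exponential_bound_iff_limit_sup_root\<close>, \<open>exponential_bound_iff_limit_inf_root\<close>).

  If such bounds hold, errors are split by a continuous cutoff into a part on which \<open>T\<^sub>w\<close> contracts and a
  part on which its inverse contracts. The first part is summed over the past, the second part over the
  future, and the sum is the required bounded solution (\<open>shadowing_of_splitting\<close>,
  \<open>shadowing_of_cutoff\<close>).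

  Conversely, shadowing is tested on a bump of height \<open>\<delta>\<close> that travels along one line, with signs that
  make the scalar equation \<open>u (j + 1) = |w (s - 1 - j)| * u j + \<delta>\<close> with \<open>|u j| \<le> 1\<close>
  (\<open>line_solution_of_shadowing\<close>). Since \<open>u\<close> is pushed upwards all the time, it changes its sign at most
  once. Where it is positive the products of the weights decay, and where it is negative they grow, at a
  rate that depends on \<open>\<delta>\<close> only (\<open>line_dichotomy\<close>). Thus every line is contracting, or expanding, or
  contracting on the left and expanding on the right. Uniform continuity of \<open>w\<close> makes the type of a line
  locally constant, so that all lines have the same type, and compactness of \<open>[0, 1]\<close> makes the bounds
  uniform (\<open>lines_to_global\<close>). The three types are the conditions (a), (b) and (c).

  The two scalar fields and the two spaces are treated at once: for the fields a real
  inner product that is compatible with the norm replaces the real part, and the two spaces are closed subspaces of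
  \<open>C\<^sub>b\<close> that are invariant under weighted shifts and contain the functions of compact support.
\<close>

section \<open>Exponential bounds and limits of n-th roots\<close>

text \<open>
  Fekete's lemma: the limit is the infimum \<open>l\<close> of the quotients. If \<open>a k / k\<close> is close to \<open>l\<close>, then
  division with remainder \<open>n = q * k + r\<close> and subadditivity bound \<open>a n / n\<close> by \<open>a k / k\<close> up to an error
  that comes from the remainder and is of order \<open>1 / n\<close>.
\<close>

lemma fekete_convergent:
  fixes a :: "nat \<Rightarrow> real"
  assumes sub: "\<And>n m. n \<ge> 1 \<Longrightarrow> m \<ge> 1 \<Longrightarrow> a (n + m) \<le> a n + a m"
    and bnd: "\<And>n. n \<ge> 1 \<Longrightarrow> \<bar>a n\<bar> \<le> B * real n"
  shows "convergent (\<lambda>n. a n / real n)"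
proof -
  define l where "l = (INF n\<in>{1..}. a n / real n)"
  have B0: "B \<ge> 0" using bnd[of 1] by simp
  have low: "- B \<le> a n / real n" if "n \<ge> 1" for n
    using bnd[OF that] that by (simp add: field_simps abs_le_iff)
  have bb: "bdd_below ((\<lambda>n. a n / real n) ` {1..})"
    using low by (intro bdd_belowI2[where m = "-B"]) auto
  have mult: "a (Suc q * k) \<le> real (Suc q) * a k" if "k \<ge> 1" for q k
  proof (induction q)
    case (Suc q)
    have "a (Suc q * k + k) \<le> a (Suc q * k) + a k" using that by (intro sub) auto
    then show ?case using Suc by (simp add: algebra_simps)
  qed simp
  have step: "a n / real n \<le> a k / real k + 2 * B * real k / real n" if k: "k \<ge> 1" and n: "n \<ge> 1" for n k
  proof -
    define q r where "q = n div k" and "r = n mod k"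
    have nqr: "n = q * k + r" and rk: "r < k" using k by (auto simp: q_def r_def)
    have "a n \<le> real q * a k + B * real r"
    proof (cases "q = 0")
      case True
      then show ?thesis using bnd[OF n] nqr by auto
    next
      case False
      then obtain q' where q': "q = Suc q'" by (cases q) auto
      show ?thesis
      proof (cases "r = 0")
        case True
        then show ?thesis using mult[OF k, of q'] q' nqr by simp
      next
        case r0: False
        have "a (q * k + r) \<le> a (q * k) + a r" using q' r0 k by (intro sub) auto
        also have "a (q * k) \<le> real q * a k" using mult[OF k, of q'] q' by simp
        also have "a r \<le> B * real r" using bnd[of r] r0 by auto
        finally show ?thesis using nqr by simp
      qed
    qed
    also have "real q * a k = real n * (a k / real k) + real r * (- (a k / real k))"
    proof -
      have "real n = real q * real k + real r" using nqr by (metis of_nat_add of_nat_mult)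
      then show ?thesis using k by (simp add: field_simps)
    qed
    also have "real r * (- (a k / real k)) \<le> real r * B"
      using low[OF k] by (intro mult_left_mono) auto
    finally have "a n \<le> real n * (a k / real k) + 2 * B * real r" by simp
    also have "2 * B * real r \<le> 2 * B * real k" using B0 rk by (intro mult_left_mono) auto
    finally show ?thesis using n by (simp add: field_simps)
  qed
  have "(\<lambda>n. a n / real n) \<longlonglongrightarrow> l"
  proof (rule LIMSEQ_I)
    fix e :: real assume e: "0 < e"
    obtain k where k: "k \<ge> 1" "a k / real k < l + e / 2"
      using cInf_lessD[of "(\<lambda>n. a n / real n) ` {1..}" "l + e/2"] e by (auto simp: l_def)
    have "(\<lambda>n. 2 * B * real k / real n) \<longlonglongrightarrow> 0"
      by (rule lim_const_over_n)
    then have "\<forall>\<^sub>F n in sequentially. 2 * B * real k / real n < e / 2"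
      using e by (intro order_tendstoD(2)[of _ 0]) auto
    then obtain N where N: "\<And>n. n \<ge> N \<Longrightarrow> 2 * B * real k / real n < e / 2"
      by (auto simp: eventually_sequentially)
    have "norm (a n / real n - l) < e" if "n \<ge> max 1 N" for n
    proof -
      have "l \<le> a n / real n" unfolding l_def using that by (intro cINF_lower[OF bb]) auto
      moreover have "a n / real n < l + e" using step[OF k(1), of n] N[of n] k(2) that by fastforce
      ultimately show ?thesis by simp
    qed
    then show "\<exists>no. \<forall>n\<ge>no. norm (a n / real n - l) < e" by blast
  qed
  then show ?thesis by (rule convergentI)
qed

text \<open>
  This removes the limits from conditions (a) and (c). In the intended use \<open>P n x\<close> is a product over
  a window of length \<open>n\<close>, and \<open>W n\<close> is the set of admissible windows; \<open>split\<close> says that an admissible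
  window of length \<open>n + m\<close> is cut into two admissible ones. Hence \<open>n * ln (b n)\<close> is subadditive, where
  \<open>b n\<close> is the supremum of the roots, and Fekete's lemma provides the limit whose existence is a part
  of the left-hand side. An exponential bound is insensitive to the finitely many small \<open>n\<close>, which is
  why it follows from the limit alone. The value at \<open>n = 0\<close>, where \<open>root 0\<close> is the zero function, does
  not affect the limit.
\<close>

lemma exponential_bound_iff_limit_sup_root:
  fixes P :: "nat \<Rightarrow> 'a \<Rightarrow> real" and W :: "nat \<Rightarrow> 'a set"
  assumes ne: "\<And>n. W n \<noteq> {}" and c: "0 < c"
    and low: "\<And>n x. x \<in> W n \<Longrightarrow> c ^ n \<le> P n x"
    and up: "\<And>n x. x \<in> W n \<Longrightarrow> P n x \<le> M ^ n"
    and split: "\<And>n m x. x \<in> W (n + m) \<Longrightarrow> \<exists>y\<in>W n. \<exists>z\<in>W m. P (n + m) x = P n y * P m z"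
  shows "(\<exists>L<1. (\<lambda>n. SUP x\<in>W n. root n (P n x)) \<longlonglongrightarrow> L) \<longleftrightarrow>
         (\<exists>C r. 0 < r \<and> r < 1 \<and> (\<forall>n. \<forall>x\<in>W n. P n x \<le> C * r ^ n))"
proof -
  define b where "b n = (SUP x\<in>W n. root n (P n x))" for n
  obtain x1 where x1: "x1 \<in> W 1" using ne by blast
  have M: "c \<le> M" using low[OF x1] up[OF x1] by simp
  have Pnn: "0 \<le> P n x" if "x \<in> W n" for n x
    using low[OF that] c by (meson zero_le_power less_imp_le order_trans)
  have rt: "root n (P n x) \<le> M" "c \<le> root n (P n x)" if "x \<in> W n" "n \<ge> 1" for n x
  proof -
    have "root n (P n x) \<le> root n (M ^ n)" using up[OF that(1)] that(2) by (intro real_root_le_mono) auto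
    then show "root n (P n x) \<le> M" using that M c by (simp add: real_root_power_cancel)
    have "root n (c ^ n) \<le> root n (P n x)" using low[OF that(1)] that(2) by (intro real_root_le_mono) auto
    then show "c \<le> root n (P n x)" using that c by (simp add: real_root_power_cancel)
  qed
  have bdd: "bdd_above ((\<lambda>x. root n (P n x)) ` W n)" if "n \<ge> 1" for n
    using rt(1) that by (intro bdd_aboveI2[where M = M]) auto
  have b_up: "root n (P n x) \<le> b n" if "x \<in> W n" "n \<ge> 1" for n x
    unfolding b_def using bdd that by (intro cSUP_upper) auto
  have b_least: "b n \<le> y" if "\<And>x. x \<in> W n \<Longrightarrow> root n (P n x) \<le> y" for n y
    unfolding b_def using ne that by (intro cSUP_least) auto
  have bM: "b n \<le> M" if "n \<ge> 1" for n using that rt by (intro b_least) auto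
  have cb: "c \<le> b n" if n: "n \<ge> 1" for n
  proof -
    obtain x where "x \<in> W n" using ne by blast
    then show ?thesis using rt(2) b_up n by (meson order_trans)
  qed
  have Pb: "P n x \<le> b n ^ n" if "x \<in> W n" "n \<ge> 1" for n x
  proof -
    have "P n x = root n (P n x) ^ n" using that Pnn by (simp add: real_root_pow_pos2)
    also have "\<dots> \<le> b n ^ n" using b_up[OF that] Pnn that by (intro power_mono) auto
    finally show ?thesis .
  qed
  have sub: "b (n + m) ^ (n + m) \<le> b n ^ n * b m ^ m" if n: "n \<ge> 1" and m: "m \<ge> 1" for n m
  proof -
    have nn: "0 \<le> b n ^ n * b m ^ m" using cb[OF n] cb[OF m] c by simp
    have "b (n + m) \<le> root (n + m) (b n ^ n * b m ^ m)"
    proof (rule b_least)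
      fix x assume "x \<in> W (n + m)"
      then obtain y z where yz: "y \<in> W n" "z \<in> W m" "P (n + m) x = P n y * P m z" using split by blast
      have "P (n + m) x \<le> b n ^ n * b m ^ m"
        unfolding yz(3) using Pb yz n m Pnn cb[OF n] c by (intro mult_mono) auto
      then show "root (n + m) (P (n + m) x) \<le> root (n + m) (b n ^ n * b m ^ m)"
        using n by (intro real_root_le_mono) auto
    qed
    then have "b (n + m) ^ (n + m) \<le> root (n + m) (b n ^ n * b m ^ m) ^ (n + m)"
      using cb[of "n + m"] n c by (intro power_mono) auto
    also have "\<dots> = b n ^ n * b m ^ m" using n nn by (intro real_root_pow_pos2) auto
    finally show ?thesis .
  qed
  have conv: "convergent b"
  proof -
    have bpos: "0 < b n" if "n \<ge> 1" for n using cb[OF that] c by linarith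
    have "convergent (\<lambda>n. (real n * ln (b n)) / real n)"
    proof (rule fekete_convergent)
      fix n m :: nat assume n: "n \<ge> 1" and m: "m \<ge> 1"
      have "ln (b (n + m) ^ (n + m)) \<le> ln (b n ^ n * b m ^ m)"
        using sub[OF n m] bpos n m by (subst ln_le_cancel_iff) auto
      then show "real (n + m) * ln (b (n + m)) \<le> real n * ln (b n) + real m * ln (b m)"
        using bpos[OF n] bpos[OF m] bpos[of "n + m"] n by (simp add: ln_mult ln_realpow)
    next
      fix n :: nat assume n: "n \<ge> 1"
      have "ln c \<le> ln (b n)" "ln (b n) \<le> ln M"
        using cb[OF n] bM[OF n] c M bpos[OF n] by simp_all
      then have "\<bar>ln (b n)\<bar> \<le> \<bar>ln c\<bar> + \<bar>ln M\<bar>" by linarith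
      then show "\<bar>real n * ln (b n)\<bar> \<le> (\<bar>ln c\<bar> + \<bar>ln M\<bar>) * real n"
        by (simp add: abs_mult mult.commute mult_left_mono)
    qed
    then obtain l where l: "(\<lambda>n. (real n * ln (b n)) / real n) \<longlonglongrightarrow> l" by (auto simp: convergent_def)
    have "(\<lambda>n. exp ((real n * ln (b n)) / real n)) \<longlonglongrightarrow> exp l" using l by (rule tendsto_exp)
    moreover have "\<forall>\<^sub>F n in sequentially. exp ((real n * ln (b n)) / real n) = b n"
      using eventually_ge_at_top[of 1] by eventually_elim (use bpos in auto)
    ultimately have "b \<longlonglongrightarrow> exp l" by (rule Lim_transform_eventually)
    then show ?thesis by (rule convergentI)
  qed
  show ?thesis unfolding b_def[symmetric]
  proof
    assume "\<exists>L<1. b \<longlonglongrightarrow> L"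
    then obtain L where L: "L < 1" "b \<longlonglongrightarrow> L" by blast
    have "c \<le> L" using L(2) by (rule tendsto_lowerbound) (use cb in \<open>auto simp: eventually_sequentially\<close>)
    define r where "r = (L + 1) / 2"
    have r: "0 < r" "r < 1" "L < r" using L \<open>c \<le> L\<close> c by (auto simp: r_def)
    obtain N where N: "\<And>n. n \<ge> N \<Longrightarrow> b n < r"
      using order_tendstoD(2)[OF L(2) r(3)] by (auto simp: eventually_sequentially)
    \<comment> \<open>The factor \<open>K ^ Suc N\<close> pays for the windows of length at most \<open>N\<close>, on which only \<open>P n x \<le> M ^ n\<close> is known.\<close>
    define K where "K = max M 1 / r"
    have K: "1 \<le> K" using r by (simp add: K_def field_simps max_def)
    have "P n x \<le> K ^ Suc N * r ^ n" if x: "x \<in> W n" for n x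
    proof (cases "n \<ge> Suc N")
      case True
      have "P n x \<le> b n ^ n" using Pb x True by auto
      also have "\<dots> \<le> r ^ n" using N[of n] True cb[of n] c by (intro power_mono) auto
      also have "\<dots> \<le> K ^ Suc N * r ^ n"
        using one_le_power[OF K, of "Suc N"] r by (simp del: power_Suc)
      finally show ?thesis .
    next
      case False
      have "P n x \<le> M ^ n" by (rule up[OF x])
      also have "\<dots> \<le> (max M 1) ^ n" using M c by (intro power_mono) auto
      also have "\<dots> = K ^ n * r ^ n" using r by (simp add: K_def power_divide)
      also have "\<dots> \<le> K ^ Suc N * r ^ n"
        using False K r by (intro mult_right_mono power_increasing) auto
      finally show ?thesis .
    qed
    then show "\<exists>C r. 0 < r \<and> r < 1 \<and> (\<forall>n. \<forall>x\<in>W n. P n x \<le> C * r ^ n)" using r by blast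
  next
    assume "\<exists>C r. 0 < r \<and> r < 1 \<and> (\<forall>n. \<forall>x\<in>W n. P n x \<le> C * r ^ n)"
    then obtain C r where r: "0 < r" "r < 1" and Cr: "\<And>n x. x \<in> W n \<Longrightarrow> P n x \<le> C * r ^ n" by blast
    obtain L where L: "b \<longlonglongrightarrow> L" using conv by (auto simp: convergent_def)
    have C: "0 < C"
    proof -
      have "0 < c ^ 1" using c by simp
      also have "\<dots> \<le> C * r ^ 1" using low[OF x1] Cr[OF x1] by linarith
      finally show ?thesis using r by (simp add: zero_less_mult_iff)
    qed
    have "(\<lambda>n. root n C * r) \<longlonglongrightarrow> 1 * r" using LIMSEQ_root_const[OF C] by (intro tendsto_intros)
    moreover have "\<forall>\<^sub>F n in sequentially. b n \<le> root n C * r"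
      using eventually_ge_at_top[of 1]
    proof eventually_elim
      case (elim n)
      show ?case
      proof (rule b_least)
        fix x assume "x \<in> W n"
        then have "root n (P n x) \<le> root n (C * r ^ n)" using Cr elim by (intro real_root_le_mono) auto
        then show "root n (P n x) \<le> root n C * r"
          using elim r by (simp add: real_root_mult real_root_power_cancel)
      qed
    qed
    ultimately have "L \<le> 1 * r" using L by (intro tendsto_le[OF sequentially_bot, where f = "\<lambda>n. root n C * r" and g = b])
    then show "\<exists>L<1. b \<longlonglongrightarrow> L" using L r by (intro exI[of _ L]) auto
  qed
qed

text \<open>
  The infimum of the roots of \<open>P\<close> is the reciprocal of the supremum of the roots of \<open>1 / P\<close>, so this is
  the previous lemma for \<open>1 / P\<close>. The two-sided bounds on \<open>P\<close> keep all quantities away from zero.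
\<close>

lemma exponential_bound_iff_limit_inf_root:
  fixes P :: "nat \<Rightarrow> 'a \<Rightarrow> real" and W :: "nat \<Rightarrow> 'a set"
  assumes ne: "\<And>n. W n \<noteq> {}" and c: "0 < c"
    and low: "\<And>n x. x \<in> W n \<Longrightarrow> c ^ n \<le> P n x"
    and up: "\<And>n x. x \<in> W n \<Longrightarrow> P n x \<le> M ^ n"
    and split: "\<And>n m x. x \<in> W (n + m) \<Longrightarrow> \<exists>y\<in>W n. \<exists>z\<in>W m. P (n + m) x = P n y * P m z"
  shows "(\<exists>L>1. (\<lambda>n. INF x\<in>W n. root n (P n x)) \<longlonglongrightarrow> L) \<longleftrightarrow>
         (\<exists>C r. 0 < r \<and> r < 1 \<and> (\<forall>n. \<forall>x\<in>W n. 1 / P n x \<le> C * r ^ n))"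
proof -
  define s where "s n = (SUP x\<in>W n. root n (1 / P n x))" for n
  obtain x1 where x1: "x1 \<in> W 1" using ne by blast
  have M: "c \<le> M" using low[OF x1] up[OF x1] by simp
  have Ppos: "0 < P n x" if "x \<in> W n" for n x
    using low[OF that] c by (meson zero_less_power less_le_trans)
  have low': "(1 / M) ^ n \<le> 1 / P n x" if "x \<in> W n" for n x
    using up[OF that] Ppos[OF that] by (simp add: power_divide frac_le)
  have up': "1 / P n x \<le> (1 / c) ^ n" if "x \<in> W n" for n x
    using low[OF that] c by (simp add: power_divide frac_le)
  have eq: "(\<exists>L<1. s \<longlonglongrightarrow> L) \<longleftrightarrow> (\<exists>C r. 0 < r \<and> r < 1 \<and> (\<forall>n. \<forall>x\<in>W n. 1 / P n x \<le> C * r ^ n))"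
    unfolding s_def
  proof (rule exponential_bound_iff_limit_sup_root[OF ne _ low' up'])
    fix n m x assume "x \<in> W (n + m)"
    then show "\<exists>y\<in>W n. \<exists>z\<in>W m. 1 / P (n + m) x = 1 / P n y * (1 / P m z)"
      using split by fastforce
  qed (use M c in auto)
  have rt: "root n (1 / P n x) \<le> 1 / c" "1 / M \<le> root n (1 / P n x)" if "x \<in> W n" "n \<ge> 1" for n x
  proof -
    have "root n (1 / P n x) \<le> root n ((1 / c) ^ n)" using up'[OF that(1)] that(2) by (intro real_root_le_mono) auto
    then show "root n (1 / P n x) \<le> 1 / c" using that c by (simp add: real_root_power_cancel)
    have "root n ((1 / M) ^ n) \<le> root n (1 / P n x)" using low'[OF that(1)] that(2) by (intro real_root_le_mono) auto
    then show "1 / M \<le> root n (1 / P n x)" using that c M by (simp add: real_root_power_cancel)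
  qed
  have bdd: "bdd_above ((\<lambda>x. root n (1 / P n x)) ` W n)" if "n \<ge> 1" for n
    using rt(1) that by (intro bdd_aboveI2[where M = "1 / c"]) auto
  have s_low: "1 / M \<le> s n" if n: "n \<ge> 1" for n
  proof -
    obtain x where x: "x \<in> W n" using ne by blast
    then have "root n (1 / P n x) \<le> s n" unfolding s_def using bdd n by (intro cSUP_upper) auto
    then show ?thesis using rt(2)[OF x n] by linarith
  qed
  have inf: "(INF x\<in>W n. root n (P n x)) = 1 / s n" if n: "n \<ge> 1" for n
  proof -
    have sp: "0 < s n" using s_low[OF n] M c by (meson divide_pos_pos less_le_trans zero_less_one)
    have rinv: "root n (1 / P n x) = 1 / root n (P n x)" for x
      using n by (simp add: real_root_divide)
    have rpos: "0 < root n (P n x)" if "x \<in> W n" for x using Ppos[OF that] n by simp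
    show ?thesis
    proof (rule antisym)
      have bb: "bdd_below ((\<lambda>x. root n (P n x)) ` W n)"
        using rpos by (intro bdd_belowI2[where m = 0]) (auto intro: less_imp_le)
      define i where "i = (INF x\<in>W n. root n (P n x))"
      have ile: "i \<le> root n (P n x)" if "x \<in> W n" for x
        unfolding i_def using bb that by (rule cINF_lower)
      have "c \<le> i" unfolding i_def
      proof (rule cINF_greatest[OF ne])
        fix x assume x: "x \<in> W n"
        have "1 / root n (P n x) \<le> 1 / c" using rt(1)[OF x n] rinv by simp
        then show "c \<le> root n (P n x)" using rpos[OF x] c by (simp add: field_simps)
      qed
      then have ip: "0 < i" using c by linarith
      have "s n \<le> 1 / i" unfolding s_def
      proof (rule cSUP_least[OF ne])
        fix x assume x: "x \<in> W n"
        show "root n (1 / P n x) \<le> 1 / i"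
          unfolding rinv using ile[OF x] ip by (intro divide_left_mono mult_pos_pos) (use rpos[OF x] in auto)
      qed
      then have "i \<le> 1 / s n" using sp ip by (simp add: field_simps)
      then show "(INF x\<in>W n. root n (P n x)) \<le> 1 / s n" by (simp add: i_def)
    next
      show "1 / s n \<le> (INF x\<in>W n. root n (P n x))"
      proof (rule cINF_greatest[OF ne])
        fix x assume x: "x \<in> W n"
        have "1 / root n (P n x) \<le> s n" unfolding s_def rinv[symmetric]
          using bdd n x by (intro cSUP_upper) auto
        then show "1 / s n \<le> root n (P n x)" using sp rpos[OF x] by (simp add: field_simps)
      qed
    qed
  qed
  have inf_ev: "\<forall>\<^sub>F n in sequentially. (INF x\<in>W n. root n (P n x)) = 1 / s n"
    using eventually_ge_at_top[of 1] by eventually_elim (rule inf)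
  show ?thesis unfolding eq[symmetric]
  proof
    assume "\<exists>L>1. (\<lambda>n. INF x\<in>W n. root n (P n x)) \<longlonglongrightarrow> L"
    then obtain L where L: "L > 1" "(\<lambda>n. INF x\<in>W n. root n (P n x)) \<longlonglongrightarrow> L" by blast
    have "(\<lambda>n. 1 / s n) \<longlonglongrightarrow> L" using Lim_transform_eventually[OF L(2) inf_ev] .
    then have "(\<lambda>n. 1 / (1 / s n)) \<longlonglongrightarrow> 1 / L" using L by (intro tendsto_intros) auto
    then have "s \<longlonglongrightarrow> 1 / L" by simp
    then show "\<exists>L<1. s \<longlonglongrightarrow> L" using L by (intro exI[of _ "1 / L"]) auto
  next
    assume "\<exists>L<1. s \<longlonglongrightarrow> L"
    then obtain L where L: "L < 1" "s \<longlonglongrightarrow> L" by blast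
    have "1 / M \<le> L"
      using L(2) by (rule tendsto_lowerbound) (use s_low in \<open>auto simp: eventually_sequentially\<close>)
    then have Lp: "0 < L" using M c by (meson divide_pos_pos less_le_trans zero_less_one)
    have "(\<lambda>n. 1 / s n) \<longlonglongrightarrow> 1 / L" using L Lp by (intro tendsto_intros) auto
    then have "(\<lambda>n. INF x\<in>W n. root n (P n x)) \<longlonglongrightarrow> 1 / L"
      by (rule Lim_transform_eventually) (use inf_ev in eventually_elim, simp)
    then show "\<exists>L>1. (\<lambda>n. INF x\<in>W n. root n (P n x)) \<longlonglongrightarrow> L"
      using L Lp by (intro exI[of _ "1 / L"]) auto
  qed
qed

section \<open>Products of the weight along the lines s + Z\<close>

text \<open>
  The iterates of \<open>T\<^sub>w\<close> are \<open>(T\<^sub>w\<^sup>n \<phi>)(x) = w x * \<dots> * w (x + n - 1) * \<phi> (x + n)\<close>; this is the modulus of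
  the weight in front.
\<close>

definition orbit_prod :: "(real \<Rightarrow> real) \<Rightarrow> nat \<Rightarrow> real \<Rightarrow> real" where
  "orbit_prod w n x = \<bar>\<Prod>j<n. w (x + real j)\<bar>"

lemma orbit_prod_0 [simp]: "orbit_prod w 0 x = 1"
  by (simp add: orbit_prod_def)

lemma orbit_prod_add: "orbit_prod w (n + m) x = orbit_prod w n x * orbit_prod w m (x + real n)"
  by (induction m) (simp_all add: orbit_prod_def abs_mult algebra_simps)

lemma orbit_prod_Suc: "orbit_prod w (Suc n) x = orbit_prod w n x * \<bar>w (x + real n)\<bar>"
  by (simp add: orbit_prod_def abs_mult)

lemma orbit_prod_Suc_shift: "orbit_prod w (Suc n) x = \<bar>w x\<bar> * orbit_prod w n (x + 1)"
  using orbit_prod_add[of w 1 n x] by (simp add: orbit_prod_def)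

lemma orbit_prod_nonneg: "0 \<le> orbit_prod w n x"
  by (simp add: orbit_prod_def)

lemma orbit_prod_le_power: "(\<And>x. \<bar>w x\<bar> \<le> M) \<Longrightarrow> orbit_prod w n x \<le> M ^ n"
  using prod_mono[of "{..<n}" "\<lambda>j. \<bar>w (x + real j)\<bar>" "\<lambda>_. M"]
  by (simp add: orbit_prod_def abs_prod)

lemma orbit_prod_ge_power: "0 < c \<Longrightarrow> (\<And>x. c \<le> \<bar>w x\<bar>) \<Longrightarrow> c ^ n \<le> orbit_prod w n x"
  using prod_mono[of "{..<n}" "\<lambda>_. c" "\<lambda>j. \<bar>w (x + real j)\<bar>"]
  by (simp add: orbit_prod_def abs_prod)

lemma orbit_prod_inverse: "orbit_prod (\<lambda>x. 1 / w x) n x = 1 / orbit_prod w n x"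
  by (simp add: orbit_prod_def prod_dividef abs_divide)

lemma orbit_prod_mono:
  assumes "\<And>j. \<bar>w (x + real j)\<bar> \<le> \<rho> * \<bar>w (y + real j)\<bar>"
  shows "orbit_prod w n x \<le> \<rho> ^ n * orbit_prod w n y"
proof -
  have "(\<Prod>j<n. \<bar>w (x + real j)\<bar>) \<le> (\<Prod>j<n. \<rho> * \<bar>w (y + real j)\<bar>)"
    using assms by (intro prod_mono) auto
  then show ?thesis by (simp add: orbit_prod_def abs_prod prod.distrib)
qed

text \<open>
  One bounded solution of the scalar equation with the constant positive forcing \<open>\<delta>\<close> decides how the
  line \<open>s + \<int>\<close> behaves. The time \<open>j\<close> corresponds to the point \<open>s - j\<close>, so later times lie further left.
  Once \<open>u\<close> is nonnegative it stays at least \<open>\<delta>\<close>, and as \<open>u \<le> 1\<close> the forcing is at least the fraction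
  \<open>\<delta>\<close> of the next value, so the homogeneous part contributes at most \<open>(1 - \<delta>) * u (j + 1)\<close>: the weights
  contract to the left. Before a nonpositive value all values are negative, and going back in time
  the homogeneous part has to overcome the forcing, so the weights expand to the right. Hence the line
  is contracting as a whole, expanding as a whole, or contracting on the left and expanding on the
  right. The opposite mixed behaviour cannot occur. The constants \<open>C\<close> and \<open>r\<close> depend neither on \<open>s\<close>
  nor on \<open>u\<close>; only the positions \<open>a\<close> and \<open>b\<close> of the transition may.
\<close>

lemma line_dichotomy:
  fixes u :: "int \<Rightarrow> real"
  assumes d: "0 < \<delta>" "\<delta> < 1" and c: "0 < c" and w: "\<And>x. c \<le> \<bar>w x\<bar>" "\<And>x. \<bar>w x\<bar> \<le> M"
    and u1: "\<And>j. \<bar>u j\<bar> \<le> 1"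
    and rec: "\<And>j. u (j + 1) = \<bar>w (s - 1 - real_of_int j)\<bar> * u j + \<delta>"
  defines "C \<equiv> (M + 1) / \<delta>" and "r \<equiv> 1 / (1 + \<delta>)"
  shows "(\<forall>n (k::int). 1 / orbit_prod w n (s + k) \<le> C * r ^ n) \<or>
         (\<exists>a. \<forall>n (k::int). s + k + real n \<le> a \<longrightarrow> orbit_prod w n (s + k) \<le> C * r ^ n)" (is ?left)
    and "(\<forall>n (k::int). orbit_prod w n (s + k) \<le> C * r ^ n) \<or>
         (\<exists>b. \<forall>n (k::int). b \<le> s + k \<longrightarrow> 1 / orbit_prod w n (s + k) \<le> C * r ^ n)" (is ?right)
proof -
  have M: "c \<le> M" using w[of 0] by linarith
  have wpos: "0 < \<bar>w x\<bar>" for x using w(1)[of x] c by linarith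
  have Ppos: "0 < orbit_prod w n x" for n x
    using orbit_prod_ge_power[of c w n x] c w by (meson zero_less_power less_le_trans)
  have r: "0 < r" "1 - \<delta> \<le> r" using d by (auto simp: r_def field_simps)
  have C: "0 < C" "1 / \<delta> \<le> C" "M / \<delta> \<le> C" using M c d by (auto simp: C_def field_simps)
  \<comment> \<open>From time \<open>m\<close> on, \<open>n\<close> steps pass the window of length \<open>n\<close> that ends just before \<open>s - m\<close>.\<close>
  have up: "u (m + int n) \<ge> 0 \<and> orbit_prod w n (s - m - real n) * u m \<le> (1 - \<delta>) ^ n * u (m + int n)"
    if m: "u m \<ge> 0" for m n
  proof (induction n)
    case (Suc n)
    let ?j = "m + int n"
    have e: "s - m - real (Suc n) = s - 1 - real_of_int ?j" "s - 1 - real_of_int ?j + 1 = s - m - real n"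
      by simp_all
    have nn: "u (?j + 1) \<ge> 0" using rec[of ?j] Suc d by simp
    have "\<bar>w (s - 1 - real_of_int ?j)\<bar> * u ?j = u (?j + 1) - \<delta>" using rec[of ?j] by simp
    also have "\<dots> \<le> (1 - \<delta>) * u (?j + 1)"
      using mult_left_le[of "u (?j + 1)" \<delta>] u1[of "?j + 1"] d by (simp add: algebra_simps)
    finally have s1: "\<bar>w (s - 1 - real_of_int ?j)\<bar> * u ?j \<le> (1 - \<delta>) * u (?j + 1)" .
    have "orbit_prod w (Suc n) (s - m - real (Suc n)) * u m
        = \<bar>w (s - 1 - real_of_int ?j)\<bar> * (orbit_prod w n (s - m - real n) * u m)"
      unfolding e(1) orbit_prod_Suc_shift e(2) by simp
    also have "\<dots> \<le> \<bar>w (s - 1 - real_of_int ?j)\<bar> * ((1 - \<delta>) ^ n * u ?j)"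
      using Suc by (intro mult_left_mono) auto
    also have "\<dots> = (1 - \<delta>) ^ n * (\<bar>w (s - 1 - real_of_int ?j)\<bar> * u ?j)" by simp
    also have "\<dots> \<le> (1 - \<delta>) ^ n * ((1 - \<delta>) * u (?j + 1))"
      using s1 d by (intro mult_left_mono) auto
    finally show ?case using nn by (simp add: algebra_simps)
  qed (use m in simp)
  \<comment> \<open>The \<open>n\<close> steps before time \<open>m\<close> pass the window of length \<open>n\<close> that starts at \<open>s - m\<close>.\<close>
  have down: "u (m - int n) \<le> 0 \<and> (1 + \<delta>) ^ n * (- u m) \<le> - u (m - int n) * orbit_prod w n (s - m)"
    if m: "u m \<le> 0" for m n
  proof (induction n)
    case (Suc n)
    let ?j = "m - int n - 1"
    have e: "s - m + real n = s - 1 - real_of_int ?j" by simp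
    have r': "\<bar>w (s - 1 - real_of_int ?j)\<bar> * u ?j = u (m - int n) - \<delta>" using rec[of ?j] by simp
    have np: "u ?j \<le> 0"
    proof (rule ccontr)
      assume "\<not> u ?j \<le> 0"
      then have "0 < \<bar>w (s - 1 - real_of_int ?j)\<bar> * u ?j" using wpos by (intro mult_pos_pos) auto
      then show False using r' Suc d by linarith
    qed
    have "(1 + \<delta>) * - u (m - int n) \<le> - u (m - int n) + \<delta>"
      using mult_left_le[of "- u (m - int n)" \<delta>] u1[of "m - int n"] d by (simp add: algebra_simps)
    then have s1: "(1 + \<delta>) * - u (m - int n) \<le> \<bar>w (s - 1 - real_of_int ?j)\<bar> * - u ?j"
      using r' by simp
    have "(1 + \<delta>) ^ Suc n * (- u m) = (1 + \<delta>) * ((1 + \<delta>) ^ n * (- u m))" by simp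
    also have "\<dots> \<le> (1 + \<delta>) * (- u (m - int n) * orbit_prod w n (s - m))"
      using Suc d by (intro mult_left_mono) auto
    also have "\<dots> = ((1 + \<delta>) * - u (m - int n)) * orbit_prod w n (s - m)" by (simp only: mult.assoc)
    also have "\<dots> \<le> (\<bar>w (s - 1 - real_of_int ?j)\<bar> * - u ?j) * orbit_prod w n (s - m)"
      using s1 by (intro mult_right_mono orbit_prod_nonneg)
    also have "\<dots> = - u ?j * orbit_prod w (Suc n) (s - m)"
      unfolding orbit_prod_Suc e by simp
    finally show ?case using np by (simp add: algebra_simps)
  qed (use m in simp)
  have contr: "orbit_prod w n (s - m - real n) \<le> C * r ^ n" if m: "\<delta> \<le> u m" for m n
  proof -
    have "orbit_prod w n (s - m - real n) * \<delta> \<le> orbit_prod w n (s - m - real n) * u m"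
      using m by (intro mult_left_mono orbit_prod_nonneg)
    also have "\<dots> \<le> (1 - \<delta>) ^ n * u (m + int n)" using up[of m n] m d by linarith
    also have "\<dots> \<le> r ^ n * 1" using u1[of "m + int n"] d r by (intro mult_mono' power_mono) (use up[of m n] m in auto)
    finally have "orbit_prod w n (s - m - real n) \<le> (1 / \<delta>) * r ^ n" using d by (simp add: field_simps)
    also have "\<dots> \<le> C * r ^ n" using C r by (intro mult_right_mono) auto
    finally show ?thesis .
  qed
  have expd: "1 / orbit_prod w n (s - m) \<le> C * r ^ n" if m: "u m \<le> - (\<delta> / M)" for m n
  proof -
    have dM: "0 < \<delta> / M" using d M c by simp
    have "(1 + \<delta>) ^ n * (\<delta> / M) \<le> (1 + \<delta>) ^ n * (- u m)" using m d by (intro mult_left_mono) auto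
    also have "\<dots> \<le> - u (m - int n) * orbit_prod w n (s - m)" using down[of m n] m dM by linarith
    also have "\<dots> \<le> 1 * orbit_prod w n (s - m)"
      using u1[of "m - int n"] by (intro mult_right_mono orbit_prod_nonneg) auto
    finally have "1 / orbit_prod w n (s - m) \<le> 1 / ((1 + \<delta>) ^ n * (\<delta> / M))"
      using Ppos d dM by (intro divide_left_mono mult_pos_pos zero_less_power) auto
    also have "\<dots> = (M / \<delta>) * r ^ n" by (simp add: r_def power_one_over field_simps)
    also have "\<dots> \<le> C * r ^ n" using C r by (intro mult_right_mono) auto
    finally show ?thesis .
  qed
  have pos_next: "\<delta> \<le> u (j + 1)" if "u j \<ge> 0" for j
    using rec[of j] that by simp
  have neg_prev: "u j \<le> - (\<delta> / M)" if "u (j + 1) \<le> 0" for j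
  proof -
    have r': "\<bar>w (s - 1 - real_of_int j)\<bar> * - u j = \<delta> - u (j + 1)" using rec[of j] by simp
    have np: "0 \<le> - u j"
    proof (rule ccontr)
      assume "\<not> 0 \<le> - u j"
      then have "\<bar>w (s - 1 - real_of_int j)\<bar> * u j > 0" using wpos by (intro mult_pos_pos) auto
      then show False using r' that d by linarith
    qed
    have "\<delta> \<le> \<bar>w (s - 1 - real_of_int j)\<bar> * - u j" using r' that by linarith
    also have "\<dots> \<le> M * - u j" using w(2) np by (intro mult_right_mono) auto
    finally show ?thesis using M c by (simp add: field_simps)
  qed
  show ?left
  proof (cases "\<exists>m. u m \<ge> 0")
    case True
    then obtain m where m: "u m \<ge> 0" by blast
    have "orbit_prod w n (s + k) \<le> C * r ^ n" if "s + k + real n \<le> s - m - 1" for n and k :: int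
    proof -
      define p where "p = nat (- k - int n - m - 1)"
      have "real_of_int (k + int n + m + 1) \<le> 0" using that by simp
      then have "k + int n + m + 1 \<le> 0" by (simp only: of_int_le_0_iff)
      then have k: "- k - int n = (m + int p) + 1" by (auto simp: p_def)
      have "\<delta> \<le> u (- k - int n)" unfolding k using up[OF m, of p] pos_next by blast
      from contr[OF this, of n] show ?thesis by simp
    qed
    then show ?thesis by blast
  next
    case False
    then have "u m \<le> - (\<delta> / M)" for m using neg_prev[of m] by (meson linear)
    from expd[OF this] have "1 / orbit_prod w n (s - real_of_int m) \<le> C * r ^ n" for n m .
    from this[of _ "- k" for k] show ?thesis by simp
  qed
  show ?right
  proof (cases "\<exists>m. u m \<le> 0")
    case True
    then obtain m where m: "u m \<le> 0" by blast
    have "1 / orbit_prod w n (s + k) \<le> C * r ^ n" if "s - m + 1 \<le> s + k" for n and k :: int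
    proof -
      define p where "p = nat (m - 1 + k)"
      have "real_of_int (1 - m - k) \<le> 0" using that by simp
      then have "1 - m - k \<le> 0" by (simp only: of_int_le_0_iff)
      then have k: "- k + 1 = m - int p" by (auto simp: p_def)
      have "u (- k + 1) \<le> 0" unfolding k using down[OF m, of p] by blast
      from expd[OF neg_prev[OF this], of n] show ?thesis by simp
    qed
    then show ?thesis by blast
  next
    case False
    then have *: "\<delta> \<le> u m" for m using pos_next[of "m - 1"] by (force simp: not_le intro: less_imp_le)
    have "orbit_prod w n (s + real_of_int k) \<le> C * r ^ n" for n k
      using contr[OF *, of n "- k - int n"] by simp
    then show ?thesis by blast
  qed
qed

text \<open>
  As \<open>|w|\<close> is bounded below, uniform continuity also holds in the multiplicative sense. This is
  what makes exponential rates stable under a small shift of the line.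
\<close>

lemma ratio_near_one:
  fixes w :: "real \<Rightarrow> real"
  assumes uc: "uniformly_continuous_on UNIV w" and c: "0 < c" "\<And>x. c \<le> \<bar>w x\<bar>" and \<rho>: "1 < \<rho>"
  obtains \<eta> where "0 < \<eta>" "\<And>x y. \<bar>x - y\<bar> < \<eta> \<Longrightarrow> \<bar>w x\<bar> \<le> \<rho> * \<bar>w y\<bar>"
proof -
  have "0 < (\<rho> - 1) * c" using c \<rho> by simp
  then obtain \<eta> where \<eta>: "0 < \<eta>" "\<And>x y. dist y x < \<eta> \<Longrightarrow> dist (w y) (w x) < (\<rho> - 1) * c"
    using uc unfolding uniformly_continuous_on_def by blast
  have "\<bar>w x\<bar> \<le> \<rho> * \<bar>w y\<bar>" if "\<bar>x - y\<bar> < \<eta>" for x y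
  proof -
    have "\<bar>w x - w y\<bar> < (\<rho> - 1) * c" using \<eta>(2)[of x y] that by (simp add: dist_real_def)
    also have "\<dots> \<le> (\<rho> - 1) * \<bar>w y\<bar>" using c \<rho> by (intro mult_left_mono) auto
    finally show ?thesis by (simp add: algebra_simps)
  qed
  then show ?thesis using \<eta>(1) that by blast
qed

lemma locally_uniform_constant:
  fixes Q :: "real \<Rightarrow> bool"
  assumes \<eta>: "0 < \<eta>" and loc: "\<And>s t. \<bar>s - t\<bar> < \<eta> \<Longrightarrow> Q s \<Longrightarrow> Q t" and "Q s"
  shows "Q t"
proof (rule connected_induction_simple[of UNIV s t Q])
  fix a :: real
  have "\<bar>x - y\<bar> < \<eta>" if "x \<in> ball a (\<eta> / 2)" "y \<in> ball a (\<eta> / 2)" for x y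
    using that unfolding mem_ball dist_real_def by linarith
  then have "\<forall>x\<in>ball a (\<eta> / 2). \<forall>y\<in>ball a (\<eta> / 2). Q x \<longrightarrow> Q y"
    using loc by blast
  then show "\<exists>T. openin (top_of_set UNIV) T \<and> a \<in> T \<and> (\<forall>x\<in>T. \<forall>y\<in>T. Q x \<longrightarrow> Q y)"
    using \<eta> by (intro exI[of _ "ball a (\<eta> / 2)"]) auto
qed (use assms in auto)

text \<open>
  The passage from single lines to bounds that are uniform on the real axis. By \<open>ratio_near_one\<close> the
  bounds of a line hold for all lines at distance less than \<open>\<eta>\<close> with a slightly worse rate \<open>r'\<close>. So a
  contracting line cannot be that close to a line that expands on the right, since a far right product
  and its reciprocal would both be exponentially small. Therefore the property of being a contracting
  line is locally constant in \<open>s\<close>, hence constant by connectedness, and in the same way the property of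
  being an expanding line. If neither holds for any line, each line has transition points, and they
  are controlled uniformly by those of finitely many lines, because every line meets the compact
  interval \<open>[0, 1]\<close>.
\<close>

lemma lines_to_global:
  assumes uc: "uniformly_continuous_on UNIV w" and c: "0 < c" "\<And>x. c \<le> \<bar>w x\<bar>"
    and r: "0 < r" "r < 1"
    and left: "\<And>s. (\<forall>n (k::int). 1 / orbit_prod w n (s + k) \<le> C * r ^ n) \<or>
         (\<exists>a. \<forall>n (k::int). s + k + real n \<le> a \<longrightarrow> orbit_prod w n (s + k) \<le> C * r ^ n)"
    and right: "\<And>s. (\<forall>n (k::int). orbit_prod w n (s + k) \<le> C * r ^ n) \<or>
         (\<exists>b. \<forall>n (k::int). b \<le> s + k \<longrightarrow> 1 / orbit_prod w n (s + k) \<le> C * r ^ n)"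
  obtains r' where "0 < r'" "r' < 1"
    "(\<forall>n x. orbit_prod w n x \<le> C * r' ^ n) \<or> (\<forall>n x. 1 / orbit_prod w n x \<le> C * r' ^ n) \<or>
     (\<exists>a b. (\<forall>n x. x + real n \<le> a \<longrightarrow> orbit_prod w n x \<le> C * r' ^ n) \<and>
            (\<forall>n x. b \<le> x \<longrightarrow> 1 / orbit_prod w n x \<le> C * r' ^ n))"
proof -
  \<comment> \<open>The margin between \<open>r\<close> and \<open>r'\<close> is used up by the distortion \<open>\<rho> ^ n\<close> between neighbouring lines.\<close>
  define r' where "r' = (r + 1) / 2"
  define \<rho> where "\<rho> = r' / r"
  have r': "0 < r'" "r' < 1" "r < r'" using r by (auto simp: r'_def)
  have \<rho>: "1 < \<rho>" "\<rho> * r = r'" using r r' by (auto simp: \<rho>_def)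
  obtain \<eta>1 where \<eta>1: "0 < \<eta>1" "\<And>x y. \<bar>x - y\<bar> < \<eta>1 \<Longrightarrow> \<bar>w x\<bar> \<le> \<rho> * \<bar>w y\<bar>"
    using ratio_near_one[OF uc c \<rho>(1)] by blast
  define \<eta> where "\<eta> = min \<eta>1 1"
  have \<eta>: "0 < \<eta>" "\<eta> \<le> 1" "\<And>x y. \<bar>x - y\<bar> < \<eta> \<Longrightarrow> \<bar>w x\<bar> \<le> \<rho> * \<bar>w y\<bar>"
    using \<eta>1 by (auto simp: \<eta>_def)
  have Ppos: "0 < orbit_prod w n x" for n x
    using orbit_prod_ge_power[of c w n x] c by (meson zero_less_power less_le_trans)
  have near: "orbit_prod w n x \<le> \<rho> ^ n * orbit_prod w n y" if "\<bar>x - y\<bar> < \<eta>" for n x y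
    using that by (intro orbit_prod_mono \<eta>(3)) auto
  have contr_near: "orbit_prod w n x \<le> C * r' ^ n"
    if "\<bar>x - y\<bar> < \<eta>" "orbit_prod w n y \<le> C * r ^ n" for n x y
  proof -
    have "orbit_prod w n x \<le> \<rho> ^ n * orbit_prod w n y" using that near by blast
    also have "\<dots> \<le> \<rho> ^ n * (C * r ^ n)" using that \<rho> by (intro mult_left_mono) auto
    also have "\<dots> = C * r' ^ n" by (simp add: power_mult_distrib flip: \<rho>(2))
    finally show ?thesis .
  qed
  have expd_near: "1 / orbit_prod w n x \<le> C * r' ^ n"
    if "\<bar>x - y\<bar> < \<eta>" "1 / orbit_prod w n y \<le> C * r ^ n" for n x y
  proof -
    have "orbit_prod w n y \<le> \<rho> ^ n * orbit_prod w n x" using that near by (simp add: abs_minus_commute)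
    then have "1 / orbit_prod w n x \<le> \<rho> ^ n * (1 / orbit_prod w n y)"
      using Ppos[of n x] Ppos[of n y] by (simp add: field_simps)
    also have "\<dots> \<le> \<rho> ^ n * (C * r ^ n)" using that \<rho> by (intro mult_left_mono) auto
    also have "\<dots> = C * r' ^ n" by (simp add: power_mult_distrib flip: \<rho>(2))
    finally show ?thesis .
  qed
  have incompatible: False
    if ex: "\<And>n. \<exists>x. orbit_prod w n x \<le> C * r' ^ n \<and> 1 / orbit_prod w n x \<le> C * r ^ n" for C
  proof -
    have "(r' * r) \<ge> 0" "r' * r < 1" using r r' mult_strict_mono[of r' 1 r 1] by auto
    then have "(\<lambda>n. C\<^sup>2 * (r' * r) ^ n) \<longlonglongrightarrow> C\<^sup>2 * 0"
      by (intro tendsto_intros LIMSEQ_power_zero) auto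
    then have "\<forall>\<^sub>F n in sequentially. C\<^sup>2 * (r' * r) ^ n < 1"
      by (intro order_tendstoD(2)) auto
    then obtain n where n: "C\<^sup>2 * (r' * r) ^ n < 1" by (auto simp: eventually_sequentially)
    obtain x where x: "orbit_prod w n x \<le> C * r' ^ n" "1 / orbit_prod w n x \<le> C * r ^ n"
      using ex by blast
    have "1 = orbit_prod w n x * (1 / orbit_prod w n x)" using Ppos[of n x] by simp
    also have "\<dots> \<le> (C * r' ^ n) * (C * r ^ n)"
      using x Ppos[of n x] order_trans[OF _ x(1), of 0] by (intro mult_mono) (auto intro: less_imp_le)
    also have "\<dots> = C\<^sup>2 * (r' * r) ^ n" by (simp add: power2_eq_square power_mult_distrib)
    finally show False using n by simp
  qed
  define LC where "LC s \<longleftrightarrow> (\<forall>n (k::int). orbit_prod w n (s + k) \<le> C * r ^ n)" for s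
  define LE where "LE s \<longleftrightarrow> (\<forall>n (k::int). 1 / orbit_prod w n (s + k) \<le> C * r ^ n)" for s
  have LC_loc: "LC t" if st: "\<bar>s - t\<bar> < \<eta>" and s: "LC s" for s t
  proof (rule ccontr)
    assume "\<not> LC t"
    then obtain b where b: "\<And>n (k::int). b \<le> t + k \<Longrightarrow> 1 / orbit_prod w n (t + k) \<le> C * r ^ n"
      using right[of t] unfolding LC_def by blast
    define k where "k = \<lceil>b - t\<rceil>"
    have "b \<le> t + k" unfolding k_def by linarith
    moreover have "orbit_prod w n (t + k) \<le> C * r' ^ n" for n
      using contr_near[of "t + k" "s + k" n] st s unfolding LC_def by (simp add: abs_minus_commute)
    ultimately show False using b incompatible by blast
  qed
  have LE_loc: "LE t" if st: "\<bar>s - t\<bar> < \<eta>" and s: "LE s" for s t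
  proof (rule ccontr)
    assume "\<not> LE t"
    then obtain a where a: "\<And>n (k::int). t + k + real n \<le> a \<Longrightarrow> orbit_prod w n (t + k) \<le> C * r ^ n"
      using left[of t] unfolding LE_def by blast
    have "\<exists>x. orbit_prod w n x \<le> C * r' ^ n \<and> 1 / orbit_prod w n x \<le> C * r ^ n" for n
    proof -
      define k where "k = \<lfloor>a - t - real n\<rfloor>"
      have "t + k + real n \<le> a" unfolding k_def by linarith
      then have "orbit_prod w n (t + k) \<le> C * r ^ n" by (rule a)
      then have "orbit_prod w n (s + k) \<le> C * r' ^ n"
        using contr_near[of "s + k" "t + k" n] st by simp
      then show ?thesis using s unfolding LE_def by blast
    qed
    then show False by (rule incompatible)
  qed
  have frac: "frac x + of_int \<lfloor>x\<rfloor> = x" "frac x \<in> {0..1}" for x :: real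
    by (simp_all add: frac_def less_imp_le) linarith+
  consider (c) s where "LC s" | (e) s where "LE s" | (m) "\<And>s. \<not> LC s" "\<And>s. \<not> LE s" by blast
  then show ?thesis
  proof cases
    case c
    then have "LC t" for t using locally_uniform_constant[of \<eta> LC s t] \<eta>(1) LC_loc by blast
    then have "orbit_prod w n t \<le> C * r ^ n" for n t unfolding LC_def by (metis add_0_right of_int_0)
    then have "orbit_prod w n t \<le> C * r' ^ n" for n t using contr_near[of t t n] \<eta> by simp
    then show ?thesis using that r' by blast
  next
    case e
    then have "LE t" for t using locally_uniform_constant[of \<eta> LE s t] \<eta>(1) LE_loc by blast
    then have "1 / orbit_prod w n t \<le> C * r ^ n" for n t unfolding LE_def by (metis add_0_right of_int_0)
    then have "1 / orbit_prod w n t \<le> C * r' ^ n" for n t using expd_near[of t t n] \<eta> by simp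
    then show ?thesis using that r' by blast
  next
    case m
    obtain a where a: "\<And>s n (k::int). s + k + real n \<le> a s \<Longrightarrow> orbit_prod w n (s + k) \<le> C * r ^ n"
      using left m(2) unfolding LE_def by metis
    obtain b where b: "\<And>s n (k::int). b s \<le> s + k \<Longrightarrow> 1 / orbit_prod w n (s + k) \<le> C * r ^ n"
      using right m(1) unfolding LC_def by metis
    obtain G :: "real set" where G: "finite G" "{0..1} \<subseteq> (\<Union>g\<in>G. ball g \<eta>)"
    proof -
      have "{0..1::real} \<subseteq> (\<Union>g\<in>{0..1}. ball g \<eta>)" using \<eta> by force
      then obtain G :: "real set" where "G \<subseteq> {0..1}" "finite G" "{0..1} \<subseteq> (\<Union>g\<in>G. ball g \<eta>)"
        by (rule compactE_image[OF compact_Icc, rotated]) auto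
      then show ?thesis using that by blast
    qed
    have close: "\<exists>g\<in>G. \<bar>x - (g + of_int \<lfloor>x\<rfloor>)\<bar> < \<eta>" for x
    proof -
      obtain g where "g \<in> G" "\<bar>g - frac x\<bar> < \<eta>" using subsetD[OF G(2) frac(2)[of x]] by (auto simp: dist_real_def)
      then show ?thesis using frac(1)[of x] by (intro bexI[of _ g]) auto
    qed
    \<comment> \<open>The shift by \<open>1\<close> covers the distance \<open>\<eta> \<le> 1\<close> to the line whose transition points are used.\<close>
    define a0 b0 where "a0 = Min (a ` G) - 1" and "b0 = Max (b ` G) + 1"
    have "orbit_prod w n x \<le> C * r' ^ n" if "x + real n \<le> a0" for n x
    proof -
      obtain g where g: "g \<in> G" "\<bar>x - (g + of_int \<lfloor>x\<rfloor>)\<bar> < \<eta>" using close by blast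
      have "a0 + 1 \<le> a g" using G(1) g by (simp add: a0_def)
      then have "g + of_int \<lfloor>x\<rfloor> + real n \<le> a g" using g(2) \<eta>(2) that by linarith
      then show ?thesis using contr_near[OF g(2)] a by blast
    qed
    moreover have "1 / orbit_prod w n x \<le> C * r' ^ n" if "b0 \<le> x" for n x
    proof -
      obtain g where g: "g \<in> G" "\<bar>x - (g + of_int \<lfloor>x\<rfloor>)\<bar> < \<eta>" using close by blast
      have "b g \<le> b0 - 1" using G(1) g by (simp add: b0_def)
      then have "b g \<le> g + of_int \<lfloor>x\<rfloor>" using g(2) \<eta>(2) that by linarith
      then show ?thesis using expd_near[OF g(2)] b by blast
    qed
    ultimately show ?thesis using that r' by blast
  qed
qed

text \<open>
  Moving the boundary of the admissible region by \<open>K\<close> unit steps costs only a constant factor: at most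
  \<open>K\<close> weights of a window lie in the new part of the region. This brings the unknown transition points
  to the origin, where condition (c) has them.
\<close>

lemma extend_windows:
  assumes M: "\<And>x. \<bar>w x\<bar> \<le> M" and r: "0 < r" "r < 1"
    and short: "\<And>n x. x \<in> V n \<Longrightarrow> orbit_prod w n x \<le> C * r ^ n"
    and cut: "\<And>n x. x \<in> W n \<Longrightarrow> K \<le> n \<Longrightarrow>
      \<exists>y z. y \<in> V (n - K) \<and> orbit_prod w n x = orbit_prod w (n - K) y * orbit_prod w K z"
  shows "\<exists>C'. \<forall>n. \<forall>x\<in>W n. orbit_prod w n x \<le> C' * r ^ n"
proof -
  define M' where "M' = max M 1"
  have M': "1 \<le> M'" "\<And>x. \<bar>w x\<bar> \<le> M'" using M by (auto simp: M'_def le_max_iff_disj)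
  define C' where "C' = max C 1 * (M' / r) ^ K"
  have Mr: "1 \<le> M' / r" using M' r by (simp add: field_simps)
  have "orbit_prod w n x \<le> C' * r ^ n" if x: "x \<in> W n" for n x
  proof (cases "K \<le> n")
    case True
    then obtain y z where yz: "y \<in> V (n - K)" "orbit_prod w n x = orbit_prod w (n - K) y * orbit_prod w K z"
      using cut x by blast
    have "orbit_prod w n x \<le> (max C 1 * r ^ (n - K)) * M' ^ K" unfolding yz(2)
    proof (intro mult_mono)
      show "orbit_prod w (n - K) y \<le> max C 1 * r ^ (n - K)"
        using short[OF yz(1)] r by (meson max.cobounded1 mult_right_mono order_trans zero_le_power less_imp_le)
    qed (use r M' orbit_prod_nonneg orbit_prod_le_power in auto)
    also have "\<dots> = C' * r ^ n"
      using True r by (simp add: C'_def power_divide power_diff field_simps)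
    finally show ?thesis .
  next
    case False
    have "orbit_prod w n x \<le> M' ^ n" using M' by (intro orbit_prod_le_power)
    also have "\<dots> = (M' / r) ^ n * r ^ n" using r by (simp add: power_divide)
    also have "\<dots> \<le> (M' / r) ^ K * r ^ n"
      using False Mr r by (intro mult_right_mono power_increasing) auto
    also have "\<dots> \<le> C' * r ^ n"
      unfolding C'_def using Mr r by (intro mult_right_mono) auto
    finally show ?thesis .
  qed
  then show ?thesis by blast
qed

lemma extend_windows_left:
  assumes M: "\<And>x. \<bar>w x\<bar> \<le> M" and r: "0 < r" "r < 1"
    and a: "\<And>n x. x + real n \<le> a \<Longrightarrow> orbit_prod w n x \<le> C * r ^ n"
  shows "\<exists>C'. \<forall>n. \<forall>x\<in>{.. - real n + 1}. orbit_prod w n x \<le> C' * r ^ n"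
proof (rule extend_windows[where V = "\<lambda>n. {x. x + real n \<le> a}" and K = "nat \<lceil>1 - a\<rceil>"])
  fix n x
  let ?K = "nat \<lceil>1 - a\<rceil>"
  assume x: "x \<in> {.. - real n + 1}" and K: "?K \<le> n"
  have "1 - a \<le> real ?K" by linarith
  then have "x \<in> {x. x + real (n - ?K) \<le> a}" using x K by (auto simp: of_nat_diff)
  moreover have "orbit_prod w n x = orbit_prod w (n - ?K) x * orbit_prod w ?K (x + real (n - ?K))"
    using orbit_prod_add[of w "n - ?K" ?K x] K by simp
  ultimately show "\<exists>y z. y \<in> {x. x + real (n - ?K) \<le> a} \<and>
      orbit_prod w n x = orbit_prod w (n - ?K) y * orbit_prod w ?K z" by blast
qed (use assms in auto)

lemma extend_windows_right:
  assumes M: "\<And>x. \<bar>w x\<bar> \<le> M" and r: "0 < r" "r < 1"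
    and b: "\<And>n x. b \<le> x \<Longrightarrow> orbit_prod w n x \<le> C * r ^ n"
  shows "\<exists>C'. \<forall>n. \<forall>x\<in>{0..}. orbit_prod w n x \<le> C' * r ^ n"
proof (rule extend_windows[where V = "\<lambda>n. {b..}" and K = "nat \<lceil>b\<rceil>"])
  fix n and x :: real
  let ?K = "nat \<lceil>b\<rceil>"
  assume x: "x \<in> {0..}" and K: "?K \<le> n"
  have "b \<le> real ?K" by linarith
  then have "x + real ?K \<in> {b..}" using x by auto
  moreover have "orbit_prod w n x = orbit_prod w (n - ?K) (x + real ?K) * orbit_prod w ?K x"
    using orbit_prod_add[of w ?K "n - ?K" x] K by simp
  ultimately show "\<exists>y z. y \<in> {b..} \<and>
      orbit_prod w n x = orbit_prod w (n - ?K) y * orbit_prod w ?K z" by blast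
qed (use assms in auto)

section \<open>Shadowing and bounded solutions of the inhomogeneous equation\<close>

text \<open>
  The forward and backward recursions are started at \<open>x 0 = 0\<close>; invertibility of \<open>T\<close> makes the backward
  one possible.
\<close>

lemma inhomogeneous_orbit_exists:
  fixes T :: "'v::real_normed_vector \<Rightarrow> 'v"
  assumes X: "subspace X" and bij: "bij_betw T X X" and e: "\<And>j::int. e j \<in> X"
  shows "\<exists>x. \<forall>j. x j \<in> X \<and> x (j + 1) = T (x j) + e j"
proof -
  define p where "p = rec_nat 0 (\<lambda>n v. T v + e (int n))"
  define m where "m = rec_nat 0 (\<lambda>n v. inv_into X T (v - e (- int (Suc n))))"
  have p: "p 0 = 0" "\<And>n. p (Suc n) = T (p n) + e (int n)" by (simp_all add: p_def)
  have m: "m 0 = 0" "\<And>n. m (Suc n) = inv_into X T (m n - e (- int (Suc n)))" by (simp_all add: m_def)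
  have TX: "T v \<in> X" "inv_into X T v \<in> X" "T (inv_into X T v) = v" if "v \<in> X" for v
    using that bij by (auto simp: bij_betw_def inv_into_into f_inv_into_f)
  have pX: "p n \<in> X" for n
    by (induction n) (use p X TX e in \<open>auto intro: subspace_add subspace_0\<close>)
  have mX: "m n \<in> X" for n
  proof (induction n)
    case (Suc n)
    then show ?case unfolding m(2) by (intro TX(2) subspace_diff[OF X] e)
  qed (simp add: m(1) subspace_0[OF X])
  define x where "x j = (if j \<ge> 0 then p (nat j) else m (nat (- j)))" for j :: int
  have "x (j + 1) = T (x j) + e j" for j
  proof (cases "j \<ge> 0")
    case True
    then show ?thesis by (simp add: x_def p nat_add_distrib)
  next
    case False
    define n where "n = nat (- j - 1)"
    have j: "j = - int (Suc n)" using False by (simp add: n_def)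
    have "x (j + 1) = m n" by (cases n) (simp_all add: x_def j p(1) m(1) nat_add_distrib)
    moreover have "x j = m (Suc n)" by (simp add: x_def j nat_add_distrib)
    moreover have "T (m (Suc n)) = m n - e j"
      using TX(3)[of "m n - e j"] mX e X j by (simp add: m subspace_diff)
    ultimately show ?thesis by simp
  qed
  moreover have "x j \<in> X" for j using pX mX by (simp add: x_def)
  ultimately show ?thesis by blast
qed

lemma int_iterate_step:
  assumes bij: "bij_betw T X X" and y: "y \<in> X"
  shows int_iterate_in: "int_iterate X T j y \<in> X"
    and int_iterate_Suc: "int_iterate X T (j + 1) y = T (int_iterate X T j y)"
proof -
  have TX: "T v \<in> X" "inv_into X T v \<in> X" "T (inv_into X T v) = v" if "v \<in> X" for v
    using that bij by (auto simp: bij_betw_def inv_into_into f_inv_into_f)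
  have pX: "(T ^^ n) y \<in> X" "(inv_into X T ^^ n) y \<in> X" for n
    by (induction n) (use y TX in auto)
  then show "int_iterate X T j y \<in> X" by (simp add: int_iterate_def)
  show "int_iterate X T (j + 1) y = T (int_iterate X T j y)"
  proof (cases "j \<ge> 0")
    case True
    then show ?thesis by (simp add: int_iterate_def nat_add_distrib)
  next
    case False
    define n where "n = nat (- j - 1)"
    have j: "j = - int (Suc n)" using False by (simp add: n_def)
    have "int_iterate X T (j + 1) = inv_into X T ^^ n"
      by (cases n) (simp_all add: int_iterate_def j nat_add_distrib)
    moreover have "int_iterate X T j = inv_into X T ^^ Suc n"
      using False by (simp add: int_iterate_def j nat_add_distrib del: funpow.simps)
    ultimately show ?thesis using TX(3)[OF pX(2)[of n]] by simp
  qed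
qed

lemma orbit_eq_int_iterate:
  assumes bij: "bij_betw T X X" and x: "\<And>j::int. x j \<in> X" "\<And>j. x (j + 1) = T (x j)"
  shows "x j = int_iterate X T j (x 0)"
proof (induction j rule: int_induct[where k = 0])
  case base
  show ?case by (simp add: int_iterate_def)
next
  case (step1 i)
  then show ?case by (simp only: x(2) int_iterate_Suc[OF bij x(1)])
next
  case (step2 i)
  have "T (x (i - 1)) = x i" using x(2)[of "i - 1"] by simp
  also have "\<dots> = T (int_iterate X T (i - 1) (x 0))"
    using int_iterate_Suc[OF bij x(1)[of 0], of "i - 1"] step2 by simp
  finally show ?case
    by (rule inj_onD[OF bij_betw_imp_inj_on[OF bij] _ x(1) int_iterate_in[OF bij x(1)]])
qed

text \<open>
  The difference of a pseudo-orbit and an orbit solves the inhomogeneous equation whose forcing is the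
  error of the pseudo-orbit, and conversely a solution of that equation turns a pseudo-orbit into an
  orbit. By homogeneity the single tolerance \<open>\<epsilon> = 1\<close> suffices.
\<close>

lemma shadowing_iff_bounded_solutions:
  fixes T :: "'v::real_normed_vector \<Rightarrow> 'v"
  assumes X: "subspace X" and lin: "linear T" and bij: "bij_betw T X X"
  shows "shadowing_property_on X T \<longleftrightarrow>
    (\<exists>\<delta>>0. \<forall>e :: int \<Rightarrow> 'v. (\<forall>j. e j \<in> X \<and> norm (e j) \<le> \<delta>) \<longrightarrow>
       (\<exists>z. \<forall>j. z j \<in> X \<and> norm (z j) < 1 \<and> z (j + 1) = T (z j) + e j))" (is "_ \<longleftrightarrow> ?R")
proof
  assume "shadowing_property_on X T"
  from this[unfolded shadowing_property_on_def, THEN spec[of _ 1], THEN mp, OF zero_less_one]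
  obtain \<delta> where \<delta>: "0 < \<delta>" and sh: "\<forall>x :: int \<Rightarrow> 'v. (\<forall>j. x j \<in> X) \<and>
      (\<forall>j. norm (T (x j) - x (j + 1)) \<le> \<delta>) \<longrightarrow> (\<exists>y\<in>X. \<forall>j. norm (x j - int_iterate X T j y) < 1)"
    by (elim exE conjE)
  have "\<exists>z. \<forall>j. z j \<in> X \<and> norm (z j) < 1 \<and> z (j + 1) = T (z j) + e j"
    if e: "\<forall>j. e j \<in> X \<and> norm (e j) \<le> \<delta>" for e :: "int \<Rightarrow> 'v"
  proof -
    obtain x where x: "\<And>j. x j \<in> X" "\<And>j. x (j + 1) = T (x j) + e j"
      using inhomogeneous_orbit_exists[OF X bij, of e] e by blast
    obtain y where y: "y \<in> X" "\<And>j. norm (x j - int_iterate X T j y) < 1"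
      using sh[THEN spec[of _ x]] x e by auto
    define z where "z j = x j - int_iterate X T j y" for j
    have "z j \<in> X" for j
      unfolding z_def by (intro subspace_diff[OF X] x(1) int_iterate_in[OF bij y(1)])
    moreover have "z (j + 1) = T (z j) + e j" for j
      by (simp only: z_def x(2) int_iterate_Suc[OF bij y(1)] linear_diff[OF lin]) simp
    ultimately show ?thesis using y(2) unfolding z_def[symmetric] by blast
  qed
  then show ?R using \<delta> by blast
next
  assume ?R
  then obtain \<delta> where \<delta>: "0 < \<delta>" and sol: "\<And>e :: int \<Rightarrow> 'v. (\<forall>j. e j \<in> X \<and> norm (e j) \<le> \<delta>) \<Longrightarrow>
       (\<exists>z. \<forall>j. z j \<in> X \<and> norm (z j) < 1 \<and> z (j + 1) = T (z j) + e j)" by blast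
  have TX: "T v \<in> X" if "v \<in> X" for v using that bij by (auto simp: bij_betw_def)
  show "shadowing_property_on X T" unfolding shadowing_property_on_def
  proof (intro allI impI)
    fix \<epsilon> :: real assume \<epsilon>: "0 < \<epsilon>"
    have "\<exists>y\<in>X. \<forall>j. norm (x j - int_iterate X T j y) < \<epsilon>"
      if x: "\<forall>j. x j \<in> X" "\<forall>j. norm (T (x j) - x (j + 1)) \<le> \<delta> * \<epsilon>" for x :: "int \<Rightarrow> 'v"
    proof -
      define e where "e j = (1 / \<epsilon>) *\<^sub>R (x (j + 1) - T (x j))" for j
      have "e j \<in> X" for j using x TX by (simp add: e_def subspace_scale[OF X] subspace_diff[OF X])
      moreover have "norm (e j) \<le> \<delta>" for j
        using x(2)[rule_format, of j] \<epsilon> by (simp add: e_def norm_minus_commute divide_le_eq)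
      ultimately have "\<forall>j. e j \<in> X \<and> norm (e j) \<le> \<delta>" by blast
      then obtain z where z: "\<And>j. z j \<in> X" "\<And>j. norm (z j) < 1" "\<And>j. z (j + 1) = T (z j) + e j"
        using sol by blast
      define o' where "o' j = x j - \<epsilon> *\<^sub>R z j" for j
      have oX: "o' j \<in> X" for j using x z by (simp add: o'_def subspace_scale[OF X] subspace_diff[OF X])
      have "o' (j + 1) = T (o' j)" for j
        using \<epsilon> unfolding o'_def z(3)
        by (simp add: e_def linear_diff[OF lin] linear_scale[OF lin] scaleR_add_right)
      then have "int_iterate X T j (o' 0) = o' j" for j
        by (rule orbit_eq_int_iterate[OF bij oX, symmetric])
      then have "x j - int_iterate X T j (o' 0) = \<epsilon> *\<^sub>R z j" for j by (simp add: o'_def[of j])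
      then show ?thesis using oX[of 0] z(2) \<epsilon> by (intro bexI[of _ "o' 0"]) auto
    qed
    then show "\<exists>\<delta>>0. \<forall>x :: int \<Rightarrow> 'v. (\<forall>j. x j \<in> X) \<and> (\<forall>j. norm (T (x j) - x (j + 1)) \<le> \<delta>) \<longrightarrow>
        (\<exists>y\<in>X. \<forall>j. norm (x j - int_iterate X T j y) < \<epsilon>)"
      using \<delta> \<epsilon> by (intro exI[of _ "\<delta> * \<epsilon>"]) auto
  qed
qed

lemma geometric_series_in_subspace:
  fixes f :: "nat \<Rightarrow> 'v::banach"
  assumes X: "subspace X" "closed X" and f: "\<And>k. f k \<in> X" "\<And>k. norm (f k) \<le> D * r ^ k"
    and r: "0 < r" "r < 1"
  shows "summable f" "suminf f \<in> X" "norm (suminf f) \<le> D / (1 - r)"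
proof -
  have s: "summable (\<lambda>k. D * r ^ k)" using r by (intro summable_mult summable_geometric) auto
  have sn: "summable (\<lambda>k. norm (f k))" by (rule summable_comparison_test'[OF s, of 0]) (use f in auto)
  then show sf: "summable f" by (rule summable_norm_cancel)
  have "(\<lambda>n. \<Sum>k<n. f k) \<longlonglongrightarrow> suminf f" using sf by (rule summable_LIMSEQ)
  then show "suminf f \<in> X"
    by (rule closed_sequentially[OF X(2), rotated]) (intro subspace_sum[OF X(1)] f(1))
  have "norm (suminf f) \<le> (\<Sum>k. norm (f k))" by (rule summable_norm[OF sn])
  also have "\<dots> \<le> (\<Sum>k. D * r ^ k)" using f sn s by (intro suminf_le)
  also have "\<dots> = D / (1 - r)" using r by (subst suminf_mult) (auto simp: suminf_geometric)
  finally show "norm (suminf f) \<le> D / (1 - r)" .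
qed

text \<open>
  The maps \<open>A k\<close> and \<open>B k\<close> stand for \<open>T\<^sup>k P\<close> and \<open>T\<^sup>-\<^sup>k (1 - P)\<close>, where \<open>P = A 0\<close> cuts a vector into a
  part that decays in the future and a part that decays in the past. The bounded solution is
  \<open>z j = (\<Sum>k. A k (e (j - 1 - k))) - (\<Sum>k. B (k + 1) (e (j + k)))\<close>:
  the first part of each error is pushed forward in time and the second part backward, so that both
  series are dominated by geometric ones.
\<close>

lemma shadowing_of_splitting:
  fixes T :: "'v::banach \<Rightarrow> 'v"
  assumes X: "subspace X" "closed X" and T: "bounded_linear T" and bij: "bij_betw T X X"
    and r: "0 < r" "r < 1"
    and A: "\<And>k v. v \<in> X \<Longrightarrow> A k v \<in> X" "\<And>k v. v \<in> X \<Longrightarrow> norm (A k v) \<le> C * r ^ k * norm v"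
    and B: "\<And>k v. v \<in> X \<Longrightarrow> B k v \<in> X" "\<And>k v. v \<in> X \<Longrightarrow> norm (B k v) \<le> C * r ^ k * norm v"
    and split: "\<And>v. v \<in> X \<Longrightarrow> A 0 v + B 0 v = v"
    and TA: "\<And>k v. v \<in> X \<Longrightarrow> T (A k v) = A (Suc k) v"
    and TB: "\<And>k v. v \<in> X \<Longrightarrow> T (B (Suc k) v) = B k v"
  shows "shadowing_property_on X T"
proof -
  interpret T: bounded_linear T by (rule T)
  \<comment> \<open>Chosen such that the bound \<open>2 * |C| * \<delta> / (1 - r)\<close> for the two geometric series is below \<open>1\<close>.\<close>
  define q where "q = 1 / (2 * \<bar>C\<bar> + 1)"
  have q: "0 < q" "2 * \<bar>C\<bar> * q < 1" by (simp_all add: q_def field_simps)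
  define \<delta> where "\<delta> = (1 - r) * q"
  have \<delta>: "0 < \<delta>" using r q by (simp add: \<delta>_def)
  have "\<exists>z. \<forall>j. z j \<in> X \<and> norm (z j) < 1 \<and> z (j + 1) = T (z j) + e j"
    if e: "\<forall>j. e j \<in> X \<and> norm (e j) \<le> \<delta>" for e :: "int \<Rightarrow> 'v"
  proof -
    have bd: "C * r ^ k * norm (e i) \<le> (\<bar>C\<bar> * \<delta>) * r ^ k" for k i
    proof -
      have "C * r ^ k * norm (e i) \<le> \<bar>C\<bar> * r ^ k * \<delta>"
        using e r by (intro mult_mono) auto
      then show ?thesis by (simp add: mult_ac)
    qed
    have An: "norm (A k (e i)) \<le> (\<bar>C\<bar> * \<delta>) * r ^ k" for k i using A(2)[of "e i" k] bd[of k i] e by force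
    have Bn: "norm (B k (e i)) \<le> (\<bar>C\<bar> * \<delta>) * r ^ k" for k i using B(2)[of "e i" k] bd[of k i] e by force
    have Bn': "norm (B (Suc k) (e i)) \<le> (\<bar>C\<bar> * \<delta>) * r ^ k" for k i
    proof -
      have "(\<bar>C\<bar> * \<delta>) * r ^ Suc k \<le> (\<bar>C\<bar> * \<delta>) * r ^ k"
        using r \<delta> by (intro mult_left_mono power_decreasing) auto
      then show ?thesis using Bn[of "Suc k" i] by linarith
    qed
    define fA where "fA j = (\<lambda>k. A k (e (j - 1 - int k)))" for j
    define fB where "fB j = (\<lambda>k. B (Suc k) (e (j + int k)))" for j
    have SA: "summable (fA j)" "suminf (fA j) \<in> X" "norm (suminf (fA j)) \<le> \<bar>C\<bar> * \<delta> / (1 - r)" for j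
      unfolding fA_def by (rule geometric_series_in_subspace[OF X _ An r]; use A e in blast)+
    have SB: "summable (fB j)" "suminf (fB j) \<in> X" "norm (suminf (fB j)) \<le> \<bar>C\<bar> * \<delta> / (1 - r)" for j
      unfolding fB_def by (rule geometric_series_in_subspace[OF X _ Bn' r]; use B e in blast)+
    define z where "z j = suminf (fA j) - suminf (fB j)" for j
    have "norm (z j) < 1" for j
    proof -
      have "norm (z j) \<le> 2 * (\<bar>C\<bar> * \<delta> / (1 - r))"
        unfolding z_def using norm_triangle_ineq4[of "suminf (fA j)" "suminf (fB j)"] SA(3)[of j] SB(3)[of j] by linarith
      also have "\<dots> = 2 * \<bar>C\<bar> * q" using r by (simp add: \<delta>_def)
      also have "\<dots> < 1" by (rule q(2))
      finally show ?thesis .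
    qed
    moreover have "z (j + 1) = T (z j) + e j" for j
    proof -
      have "suminf (fA (j + 1)) = fA (j + 1) 0 + (\<Sum>k. fA (j + 1) (Suc k))"
        using suminf_split_head[OF SA(1)[of "j + 1"]] by simp
      also have "(\<Sum>k. fA (j + 1) (Suc k)) = (\<Sum>k. T (fA j k))"
        using TA e by (intro suminf_cong) (auto simp: fA_def algebra_simps)
      also have "\<dots> = T (suminf (fA j))" using T.suminf[OF SA(1)] by simp
      finally have a: "suminf (fA (j + 1)) = A 0 (e j) + T (suminf (fA j))" by (simp add: fA_def)
      have Tsum: "summable (\<lambda>k. T (fB j k))" using T.summable[OF SB(1)] .
      have "T (suminf (fB j)) = (\<Sum>k. T (fB j k))" using T.suminf[OF SB(1)] .
      also have "\<dots> = T (fB j 0) + (\<Sum>k. T (fB j (Suc k)))"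
        using suminf_split_head[OF Tsum] by simp
      also have "(\<Sum>k. T (fB j (Suc k))) = suminf (fB (j + 1))"
        using TB e by (intro suminf_cong) (auto simp: fB_def algebra_simps)
      finally have b: "T (suminf (fB j)) = B 0 (e j) + suminf (fB (j + 1))" using TB e by (simp add: fB_def)
      have "z (j + 1) = T (z j) + (A 0 (e j) + B 0 (e j))" by (simp add: z_def T.diff a b)
      then show ?thesis using split e by simp
    qed
    moreover have "z j \<in> X" for j using SA SB X by (simp add: z_def subspace_diff)
    ultimately show ?thesis by blast
  qed
  then show ?thesis
    using shadowing_iff_bounded_solutions[OF X(1) T.linear_axioms bij] \<delta> by blast
qed

section \<open>Weighted translations on C0 and Cb\<close>

text \<open>
  This class of operators contains \<open>T\<^sub>w\<close>, its inverse, the multiplication by a cutoff function, and is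
  closed under composition (for bounded continuous weights).
\<close>

definition weighted_shift :: "real \<Rightarrow> (real \<Rightarrow> real) \<Rightarrow> (real \<Rightarrow>\<^sub>C 'k) \<Rightarrow> (real \<Rightarrow>\<^sub>C 'k::real_normed_field)" where
  "weighted_shift h v \<phi> = Bcontfun (\<lambda>x. \<phi> (x + h) * of_real (v x))"

lemma weighted_translation_eq: "weighted_translation w = weighted_shift 1 w"
  by (rule ext) (simp add: weighted_translation_def weighted_shift_def)

lemma weighted_shift_apply:
  assumes v: "continuous_on UNIV v" "\<And>x. \<bar>v x\<bar> \<le> B"
  shows "apply_bcontfun (weighted_shift h v \<phi>) x = \<phi> (x + h) * of_real (v x)"
proof -
  have "continuous_on UNIV (\<lambda>x. \<phi> (x + h) * of_real (v x))"
    by (intro continuous_intros v continuous_on_compose2[OF continuous_on_apply_bcontfun[of UNIV \<phi>]]) auto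
  moreover have "norm (\<phi> (x + h) * of_real (v x)) \<le> norm \<phi> * B" for x
    unfolding norm_mult using v(2)[of x] norm_bounded[of \<phi> "x + h"]
    by (intro mult_mono) auto
  ultimately have "(\<lambda>x. \<phi> (x + h) * of_real (v x)) \<in> bcontfun" by (rule bcontfun_normI)
  then show ?thesis by (simp add: weighted_shift_def Bcontfun_inverse)
qed

lemma norm_weighted_shift_le:
  assumes v: "continuous_on UNIV v" "\<And>x. \<bar>v x\<bar> \<le> B"
  shows "norm (weighted_shift h v \<phi>) \<le> B * norm \<phi>"
proof (rule norm_bound)
  fix x
  have "norm (\<phi> (x + h)) * \<bar>v x\<bar> \<le> norm \<phi> * B"
    using v(2)[of x] norm_bounded[of \<phi> "x + h"] by (intro mult_mono) auto
  then show "norm (apply_bcontfun (weighted_shift h v \<phi>) x) \<le> B * norm \<phi>"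
    by (simp add: weighted_shift_apply[OF v] norm_mult mult.commute)
qed

lemma bounded_linear_weighted_shift:
  assumes v: "continuous_on UNIV v" "\<And>x. \<bar>v x\<bar> \<le> B"
  shows "bounded_linear (weighted_shift h v)"
proof (rule bounded_linear_intro)
  show "norm (weighted_shift h v \<phi>) \<le> norm \<phi> * B" for \<phi>
    using norm_weighted_shift_le[OF v] by (simp add: mult.commute)
qed (auto intro!: bcontfun_eqI simp: weighted_shift_apply[OF v] algebra_simps)

lemma weighted_shift_compose:
  assumes v: "continuous_on UNIV v" "\<And>x. \<bar>v x\<bar> \<le> B" and u: "continuous_on UNIV u" "\<And>x. \<bar>u x\<bar> \<le> D"
    and t: "continuous_on UNIV t" "\<And>x. \<bar>t x\<bar> \<le> E" and eq: "\<And>x. v x * u (x + h) = t x"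
  shows "weighted_shift h v (weighted_shift k u \<phi>) = weighted_shift (h + k) t \<phi>"
  by (rule bcontfun_eqI)
    (simp add: weighted_shift_apply[OF v] weighted_shift_apply[OF u] weighted_shift_apply[OF t] add.assoc
      flip: eq)

lemma weighted_shift_id: "weighted_shift 0 (\<lambda>_. 1) \<phi> = \<phi>"
  by (rule bcontfun_eqI) (simp add: weighted_shift_apply[where B = 1])

lemma weighted_shift_C0:
  assumes v: "continuous_on UNIV v" "\<And>x. \<bar>v x\<bar> \<le> B" and \<phi>: "\<phi> \<in> C0_R"
  shows "weighted_shift h v \<phi> \<in> C0_R"
proof -
  have "filterlim (\<lambda>x. h + x) at_infinity (at_infinity :: real filter)"
    by (intro tendsto_add_filterlim_at_infinity[OF tendsto_const] filterlim_ident)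
  then have "((\<lambda>x. \<phi> (x + h)) \<longlongrightarrow> 0) at_infinity"
    using \<phi> filterlim_compose[of \<phi> "nhds 0" at_infinity] by (simp add: C0_R_def add.commute)
  then have "((\<lambda>x. \<phi> (x + h) * of_real (v x)) \<longlongrightarrow> 0) at_infinity"
    by (rule tendsto_0_le[where K = B])
      (use v(2) in \<open>auto simp: norm_mult intro!: always_eventually mult_left_mono\<close>)
  moreover have "apply_bcontfun (weighted_shift h v \<phi>) = (\<lambda>x. \<phi> (x + h) * of_real (v x))"
    by (rule ext) (rule weighted_shift_apply[OF v])
  ultimately show ?thesis by (simp add: C0_R_def)
qed

lemma subspace_C0: "subspace C0_R"
proof (rule subspaceI)
  show "0 \<in> (C0_R :: (real \<Rightarrow>\<^sub>C 'a) set)" by (simp add: C0_R_def zero_bcontfun.rep_eq)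
  show "\<phi> + \<psi> \<in> C0_R" if "\<phi> \<in> C0_R" "\<psi> \<in> C0_R" for \<phi> \<psi> :: "real \<Rightarrow>\<^sub>C 'a"
    using tendsto_add[of \<phi> 0 at_infinity \<psi> 0] that by (simp add: C0_R_def plus_bcontfun.rep_eq[abs_def])
  show "c *\<^sub>R \<phi> \<in> C0_R" if "\<phi> \<in> C0_R" for c and \<phi> :: "real \<Rightarrow>\<^sub>C 'a"
    using tendsto_scaleR[OF tendsto_const[of c], of \<phi> 0 at_infinity] that by (simp add: C0_R_def)
qed

lemma closed_C0: "closed C0_R"
  unfolding closed_sequential_limits
proof safe
  fix f :: "nat \<Rightarrow> (real \<Rightarrow>\<^sub>C 'a)" and l
  assume f: "\<forall>n. f n \<in> C0_R" and lim: "f \<longlonglongrightarrow> l"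
  have "(apply_bcontfun l \<longlongrightarrow> 0) at_infinity"
  proof (rule tendstoI)
    fix e :: real assume e: "0 < e"
    then have "\<forall>\<^sub>F n in sequentially. dist (f n) l < e / 2" using tendstoD[OF lim, of "e / 2"] by simp
    then obtain n where n: "dist (f n) l < e / 2" by (auto simp: eventually_sequentially)
    have "(apply_bcontfun (f n) \<longlongrightarrow> 0) at_infinity" using f by (simp add: C0_R_def)
    then have "\<forall>\<^sub>F x in at_infinity. dist (f n x) 0 < e / 2" using e by (intro tendstoD) auto
    then show "\<forall>\<^sub>F x in at_infinity. dist (l x) 0 < e"
    proof eventually_elim
      case (elim x)
      have "dist (f n x) (l x) < e / 2" using n by (rule dist_fun_lt_imp_dist_val_lt)
      then show ?case using elim dist_triangle_half_r[of "f n x" "l x" e 0] by simp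
    qed
  qed
  then show "l \<in> C0_R" by (simp add: C0_R_def)
qed

lemma C0_or_Cb:
  assumes "X \<in> {C0_R, Cb_R}"
  shows subspace_C0_or_Cb: "subspace X" and closed_C0_or_Cb: "closed X"
    and weighted_shift_C0_or_Cb: "continuous_on UNIV v \<Longrightarrow> (\<And>x. \<bar>v x\<bar> \<le> B) \<Longrightarrow> \<phi> \<in> X \<Longrightarrow> weighted_shift h v \<phi> \<in> X"
    and C0_in_C0_or_Cb: "\<phi> \<in> C0_R \<Longrightarrow> \<phi> \<in> X"
  using assms subspace_C0 closed_C0 weighted_shift_C0[of v B \<phi> h] by (auto simp: Cb_R_def)

lemma scale_bcontfun_apply: "apply_bcontfun (scale_bcontfun c \<phi>) x = c * \<phi> x"
proof -
  have "(\<lambda>x. c * \<phi> x) \<in> bcontfun"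
    by (rule bcontfun_normI[where b = "norm c * norm \<phi>"])
      (auto simp: norm_mult intro!: continuous_intros mult_left_mono norm_bounded)
  then show ?thesis by (simp add: scale_bcontfun_def Bcontfun_inverse)
qed

lemma bij_betw_weighted_shift:
  assumes X: "X \<in> {C0_R, Cb_R :: (real \<Rightarrow>\<^sub>C 'k::real_normed_field) set}"
    and w: "continuous_on UNIV w" "\<And>x. \<bar>w x\<bar> \<le> M" and c: "0 < c" "\<And>x. c \<le> \<bar>w x\<bar>"
  shows "bij_betw (weighted_shift 1 w) X X"
proof -
  define v where "v x = 1 / w (x - 1)" for x
  have w0: "w x \<noteq> 0" for x using c(2)[of x] c(1) by auto
  have v: "continuous_on UNIV v"
    unfolding v_def by (intro continuous_intros continuous_on_compose2[OF w(1)]) (use w0 in auto)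
  have vb: "\<bar>v x\<bar> \<le> 1 / c" for x
    using c(2)[of "x - 1"] c(1) by (simp add: v_def frac_le)
  have one: "continuous_on UNIV (\<lambda>_::real. 1::real)" "\<And>x::real. \<bar>1::real\<bar> \<le> 1" by simp_all
  have vw: "v x * w (x + - 1) = 1" "w x * v (x + 1) = 1" for x by (simp_all add: v_def w0)
  show ?thesis
  proof (rule bij_betw_byWitness[where f' = "weighted_shift (-1) v"])
    show "\<forall>\<phi>\<in>X. weighted_shift (- 1) v (weighted_shift 1 w \<phi>) = \<phi>"
      using weighted_shift_compose[OF v vb w one vw(1), of 1, where 'a = 'k] by (simp add: weighted_shift_id)
    show "\<forall>\<phi>\<in>X. weighted_shift 1 w (weighted_shift (- 1) v \<phi>) = \<phi>"
      using weighted_shift_compose[OF w v vb one vw(2), of "-1", where 'a = 'k] by (simp add: weighted_shift_id)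
  qed (use weighted_shift_C0_or_Cb[OF X] w v vb in blast)+
qed

lemma invertible_weighted_translation:
  assumes X: "X \<in> {C0_R, Cb_R :: (real \<Rightarrow>\<^sub>C 'k::real_normed_field) set}"
    and w: "continuous_on UNIV w" "\<And>x. \<bar>w x\<bar> \<le> M" and c: "0 < c" "\<And>x. c \<le> \<bar>w x\<bar>"
  shows "invertible_operator_on X (weighted_translation w)"
proof -
  interpret T: bounded_linear "weighted_shift 1 w :: (real \<Rightarrow>\<^sub>C 'k) \<Rightarrow> _"
    by (rule bounded_linear_weighted_shift[OF w])
  have "weighted_shift 1 w (scale_bcontfun a \<phi>) = scale_bcontfun a (weighted_shift 1 w \<phi>)"
    for a and \<phi> :: "real \<Rightarrow>\<^sub>C 'k"
    by (rule bcontfun_eqI) (simp add: weighted_shift_apply[OF w] scale_bcontfun_apply)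
  then show ?thesis
    unfolding invertible_operator_on_def weighted_translation_eq
    using bij_betw_weighted_shift[OF X w c] T.add T.continuous_on[OF continuous_on_id] by auto
qed

text \<open>
  The bounded solutions in \<open>C\<^sub>b\<close> are sums of absolutely convergent series.
\<close>

instance bcontfun :: (metric_space, banach) banach ..

text \<open>
  The splitting is the multiplication by a continuous cutoff \<open>\<kappa>\<close> and by \<open>1 - \<kappa>\<close>. At \<open>x\<close> the function
  \<open>T\<^sub>w\<^sup>n (\<kappa> \<phi>)\<close> involves \<open>\<kappa> (x + n)\<close> and the product over the window that starts at \<open>x\<close>, and
  \<open>T\<^sub>w\<^sup>-\<^sup>n ((1 - \<kappa>) \<phi>)\<close> involves \<open>1 - \<kappa> (x - n)\<close> and the reciprocal of the product over the window that
  starts at \<open>x - n\<close>. So the decay is needed only on windows ending in the support of \<open>\<kappa>\<close> and on windows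
  starting in that of \<open>1 - \<kappa>\<close>.
\<close>

lemma shadowing_of_cutoff:
  fixes X :: "(real \<Rightarrow>\<^sub>C 'k::{real_normed_field,banach}) set"
    and \<kappa> :: "real \<Rightarrow> real"
  assumes X: "X \<in> {C0_R, Cb_R}"
    and w: "continuous_on UNIV w" "\<And>x. \<bar>w x\<bar> \<le> M" and c: "0 < c" "\<And>x. c \<le> \<bar>w x\<bar>"
    and r: "0 < r" "r < 1"
    and \<kappa>: "continuous_on UNIV \<kappa>" "\<And>x. 0 \<le> \<kappa> x" "\<And>x. \<kappa> x \<le> 1"
    and contracting: "\<And>n x. \<kappa> (x + real n) \<noteq> 0 \<Longrightarrow> orbit_prod w n x \<le> C * r ^ n"
    and expanding: "\<And>n x. \<kappa> x \<noteq> 1 \<Longrightarrow> 1 / orbit_prod w n x \<le> C * r ^ n"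
  shows "shadowing_property_on X (weighted_translation w)"
proof -
  have w0: "w x \<noteq> 0" for x using c(2)[of x] c(1) by auto
  define G where "G n x = (\<Prod>j<n. w (x + real j))" for n x
  have GP: "\<bar>G n x\<bar> = orbit_prod w n x" for n x by (simp add: G_def orbit_prod_def)
  have G0: "G n x \<noteq> 0" for n x by (simp add: G_def w0)
  have GS: "G (Suc n) x = G n x * w (x + real n)" for n x by (simp add: G_def)
  have GS': "G (Suc n) x = w x * G n (x + 1)" for n x
    by (induction n) (simp_all add: G_def algebra_simps)
  have contG: "continuous_on UNIV (G n)" for n
    unfolding G_def by (intro continuous_intros continuous_on_compose2[OF w(1)]) auto
  \<comment> \<open>The weights of \<open>T\<^sub>w\<^sup>n \<circ> \<kappa>\<close> and of \<open>T\<^sub>w\<^sup>-\<^sup>n \<circ> (1 - \<kappa>)\<close> as weighted shifts.\<close>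
  define a where "a n x = G n x * \<kappa> (x + real n)" for n x
  define b where "b n x = (1 - \<kappa> (x - real n)) / G n (x - real n)" for n x
  have ca: "continuous_on UNIV (a n)" for n unfolding a_def
    by (intro continuous_intros contG continuous_on_compose2[OF \<kappa>(1)]) auto
  have cb: "continuous_on UNIV (b n)" for n unfolding b_def
    by (intro continuous_intros continuous_on_compose2[OF contG] continuous_on_compose2[OF \<kappa>(1)]) (use G0 in auto)
  have wa: "w x * a n (x + 1) = a (Suc n) x" for n x
    by (simp add: a_def GS' algebra_simps)
  have wb: "w x * b (Suc n) (x + 1) = b n x" for n x
  proof -
    have y: "x + 1 - real (Suc n) = x - real n" by simp
    show ?thesis unfolding b_def y GS using w0 by simp
  qed
  have C: "0 \<le> C"
    using contracting[of 0 0] expanding[of 0 0] by (cases "\<kappa> 0 = 0") auto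
  have ba: "\<bar>a n x\<bar> \<le> C * r ^ n" for n x
  proof (cases "\<kappa> (x + real n) = 0")
    case False
    have "\<bar>a n x\<bar> \<le> orbit_prod w n x"
      using \<kappa>(2,3)[of "x + real n"] orbit_prod_nonneg[of w n x]
      by (simp add: a_def abs_mult GP mult_left_le)
    then show ?thesis using contracting[OF False] by linarith
  qed (use C r in \<open>simp add: a_def\<close>)
  have bb: "\<bar>b n x\<bar> \<le> C * r ^ n" for n x
  proof (cases "\<kappa> (x - real n) = 1")
    case False
    have "\<bar>b n x\<bar> \<le> 1 / orbit_prod w n (x - real n)"
      using \<kappa>(2,3)[of "x - real n"] orbit_prod_nonneg[of w n "x - real n"]
      by (simp add: b_def abs_divide GP divide_right_mono)
    then show ?thesis using expanding[OF False, of n] by linarith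
  qed (use C r in \<open>simp add: b_def\<close>)
  show ?thesis unfolding weighted_translation_eq
  proof (rule shadowing_of_splitting[where A = "\<lambda>n. weighted_shift (real n) (a n)"
        and B = "\<lambda>n. weighted_shift (- real n) (b n)"])
    show "subspace X" "closed X" by (rule subspace_C0_or_Cb[OF X], rule closed_C0_or_Cb[OF X])
    show "bounded_linear (weighted_shift 1 w :: (real \<Rightarrow>\<^sub>C 'k) \<Rightarrow> _)" by (rule bounded_linear_weighted_shift[OF w])
    show "bij_betw (weighted_shift 1 w) X X" by (rule bij_betw_weighted_shift[OF X w c])
    show "0 < r" "r < 1" by (fact r)+
    fix n and \<phi> :: "real \<Rightarrow>\<^sub>C 'k" assume \<phi>: "\<phi> \<in> X"
    show "weighted_shift (real n) (a n) \<phi> \<in> X" by (rule weighted_shift_C0_or_Cb[OF X ca ba \<phi>])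
    show "weighted_shift (- real n) (b n) \<phi> \<in> X" by (rule weighted_shift_C0_or_Cb[OF X cb bb \<phi>])
    show "norm (weighted_shift (real n) (a n) \<phi>) \<le> C * r ^ n * norm \<phi>" by (rule norm_weighted_shift_le[OF ca ba])
    show "norm (weighted_shift (- real n) (b n) \<phi>) \<le> C * r ^ n * norm \<phi>" by (rule norm_weighted_shift_le[OF cb bb])
    show "weighted_shift 1 w (weighted_shift (real n) (a n) \<phi>) = weighted_shift (real (Suc n)) (a (Suc n)) \<phi>"
      using weighted_shift_compose[OF w ca ba ca ba wa[of _ n], of "real n" \<phi>] by simp
    show "weighted_shift 1 w (weighted_shift (- real (Suc n)) (b (Suc n)) \<phi>) = weighted_shift (- real n) (b n) \<phi>"
      using weighted_shift_compose[OF w cb bb cb bb wb[of _ n], of "- real (Suc n)" \<phi>] by simp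
  next
    fix \<phi> :: "real \<Rightarrow>\<^sub>C 'k"
    show "weighted_shift (real 0) (a 0) \<phi> + weighted_shift (- real 0) (b 0) \<phi> = \<phi>"
      by (rule bcontfun_eqI)
        (simp add: weighted_shift_apply[OF ca ba] weighted_shift_apply[OF cb bb] a_def b_def G_def algebra_simps)
  qed
qed

lemma sgn_constant:
  fixes w :: "real \<Rightarrow> real"
  assumes w: "continuous_on UNIV w" "\<And>x. w x \<noteq> 0"
  shows "sgn (w x) = sgn (w y)"
proof (rule ccontr)
  assume "sgn (w x) \<noteq> sgn (w y)"
  then have "w x < 0 \<and> 0 < w y \<or> w y < 0 \<and> 0 < w x"
    using w(2)[of x] w(2)[of y] by (auto simp: sgn_if split: if_splits)
  moreover have "connected (range w)" using w(1) by (rule connected_continuous_image) simp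
  ultimately have "0 \<in> range w" by (auto intro: connectedD_interval less_imp_le)
  then show False using w(2) by force
qed

text \<open>
  If \<open>z (j + 1) = T\<^sub>w (z j) + e j\<close>, then the values \<open>z j (s - j)\<close> solve a scalar equation with the
  multipliers \<open>w (s - 1 - j)\<close> and the forcing \<open>e j (s - 1 - j)\<close>. The signs of the multipliers are removed
  by a sign sequence \<open>\<theta>\<close>, which has period two because \<open>w\<close> has no zero and hence a constant sign. The
  forcing is a bump of height \<open>\<delta>\<close> that travels along the line; its compact support puts it into both
  spaces. The inner product with \<open>1\<close> is the real part, for both scalar fields.
\<close>

lemma line_solution_of_shadowing:
  fixes X :: "(real \<Rightarrow>\<^sub>C 'k::{real_normed_field,real_inner}) set"
  assumes X: "X \<in> {C0_R, Cb_R}"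
    and w: "continuous_on UNIV w" "\<And>x. \<bar>w x\<bar> \<le> M" and c: "0 < c" "\<And>x. c \<le> \<bar>w x\<bar>"
    and sh: "shadowing_property_on X (weighted_translation w)"
  obtains \<delta> where "0 < \<delta>" "\<delta> < 1"
    "\<And>s. \<exists>u :: int \<Rightarrow> real. \<forall>j. \<bar>u j\<bar> \<le> 1 \<and> u (j + 1) = \<bar>w (s - 1 - real_of_int j)\<bar> * u j + \<delta>"
proof -
  have w0: "w x \<noteq> 0" for x using c(2)[of x] c(1) by auto
  have lin: "linear (weighted_shift 1 w :: (real \<Rightarrow>\<^sub>C 'k) \<Rightarrow> _)"
    using bounded_linear_weighted_shift[OF w] by (rule bounded_linear.linear)
  obtain \<delta>1 where \<delta>1: "0 < \<delta>1" and sol: "\<And>e :: int \<Rightarrow> (real \<Rightarrow>\<^sub>C 'k). (\<forall>j. e j \<in> X \<and> norm (e j) \<le> \<delta>1) \<Longrightarrow>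
       (\<exists>z. \<forall>j. z j \<in> X \<and> norm (z j) < 1 \<and> z (j + 1) = weighted_shift 1 w (z j) + e j)"
    using sh unfolding weighted_translation_eq
      shadowing_iff_bounded_solutions[OF subspace_C0_or_Cb[OF X] lin bij_betw_weighted_shift[OF X w c]] by blast
  \<comment> \<open>The forcing may be made smaller, which secures \<open>\<delta> < 1\<close>.\<close>
  define \<delta> where "\<delta> = min \<delta>1 (1 / 2)"
  have \<delta>: "0 < \<delta>" "\<delta> < 1" "\<delta> \<le> \<delta>1" using \<delta>1 by (auto simp: \<delta>_def)
  define \<sigma> where "\<sigma> = sgn (w 0)"
  have \<sigma>: "\<sigma> * \<sigma> = 1" "\<bar>\<sigma>\<bar> = 1" using w0[of 0] by (auto simp: \<sigma>_def sgn_if)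
  have \<sigma>w: "\<sigma> * w x = \<bar>w x\<bar>" for x
    using sgn_constant[OF w(1) w0, of 0 x] unfolding \<sigma>_def by (simp add: sgn_if split: if_splits)
  define \<theta> where "\<theta> j = (if even j then 1 else \<sigma>)" for j :: int
  have \<theta>: "\<theta> j * \<theta> j = 1" "\<bar>\<theta> j\<bar> = 1" "\<theta> (j + 1) = \<sigma> * \<theta> j" for j
    using \<sigma> by (auto simp: \<theta>_def)
  have "\<exists>u :: int \<Rightarrow> real. \<forall>j. \<bar>u j\<bar> \<le> 1 \<and> u (j + 1) = \<bar>w (s - 1 - real_of_int j)\<bar> * u j + \<delta>" for s
  proof -
    define f where "f j x = \<delta> * \<theta> (j + 1) * max 0 (1 - \<bar>x + real_of_int j + 1 - s\<bar>)" for j x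
    define e :: "int \<Rightarrow> (real \<Rightarrow>\<^sub>C 'k)" where "e j = Bcontfun (\<lambda>x. of_real (f j x))" for j
    have fb: "\<bar>f j x\<bar> \<le> \<delta>" for j x
      using \<delta> \<theta>(2)[of "j + 1"] by (simp add: f_def abs_mult mult_left_le)
    have cf: "continuous_on UNIV (f j)" for j
      unfolding f_def by (intro continuous_intros)
    have e_apply: "apply_bcontfun (e j) x = of_real (f j x)" for j x
    proof -
      have "(\<lambda>x. of_real (f j x) :: 'k) \<in> bcontfun"
        by (rule bcontfun_normI[where b = \<delta>]) (use cf fb in \<open>auto intro: continuous_on_of_real\<close>)
      then show ?thesis by (simp add: e_def Bcontfun_inverse)
    qed
    have "e j \<in> C0_R" for j
    proof -
      have "apply_bcontfun (e j) x = 0" if "1 + \<bar>real_of_int j + 1 - s\<bar> \<le> norm x" for x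
      proof -
        have "1 - \<bar>x + real_of_int j + 1 - s\<bar> \<le> 0" using that by simp
        then show ?thesis by (simp add: e_apply f_def)
      qed
      then have "\<forall>\<^sub>F x in at_infinity. apply_bcontfun (e j) x = 0"
        unfolding eventually_at_infinity by blast
      then show ?thesis by (simp add: C0_R_def tendsto_eventually)
    qed
    then have "\<forall>j. e j \<in> X \<and> norm (e j) \<le> \<delta>1"
      using C0_in_C0_or_Cb[OF X] order_trans[OF fb \<delta>(3)] by (auto intro!: norm_bound simp: e_apply)
    then obtain z where z: "\<And>j. norm (z j) < 1" "\<And>j. z (j + 1) = weighted_shift 1 w (z j) + e j"
      using sol by blast
    define u where "u j = \<theta> j * inner (apply_bcontfun (z j) (s - real_of_int j)) 1" for j
    have "\<bar>u j\<bar> \<le> 1" for j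
    proof -
      have "\<bar>inner (apply_bcontfun (z j) (s - real_of_int j)) 1\<bar> \<le> norm (apply_bcontfun (z j) (s - real_of_int j)) * norm (1 :: 'k)"
        by (rule Cauchy_Schwarz_ineq2)
      also have "\<dots> \<le> 1" using norm_bounded[of "z j" "s - real_of_int j"] z(1)[of j] by simp
      finally show ?thesis using \<theta>(2)[of j] by (simp add: u_def abs_mult)
    qed
    moreover have "u (j + 1) = \<bar>w (s - 1 - real_of_int j)\<bar> * u j + \<delta>" for j
    proof -
      let ?x = "s - 1 - real_of_int j"
      have inner_real: "inner (a * of_real t) 1 = t * inner a (1 :: 'k)" for a t
        by (metis inner_scaleR_left mult.commute scaleR_conv_of_real)
      have one: "inner (1::'k) 1 = 1" by (metis norm_one power2_norm_eq_inner power_one)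
      have "apply_bcontfun (z (j + 1)) ?x = apply_bcontfun (z j) (?x + 1) * of_real (w ?x) + 1 * of_real (f j ?x)"
        unfolding z(2) by (simp add: weighted_shift_apply[OF w] e_apply)
      then have "inner (apply_bcontfun (z (j + 1)) ?x) 1 = w ?x * inner (apply_bcontfun (z j) (s - real_of_int j)) 1 + f j ?x"
        unfolding inner_add_left inner_real by (simp add: inner_add_left inner_real one algebra_simps)
      moreover have "f j ?x = \<delta> * \<theta> (j + 1)" by (simp add: f_def)
      moreover have "u (j + 1) = \<theta> (j + 1) * inner (apply_bcontfun (z (j + 1)) ?x) 1"
        by (simp add: u_def algebra_simps)
      ultimately have "u (j + 1) = (\<theta> (j + 1) * w ?x) * inner (apply_bcontfun (z j) (s - real_of_int j)) 1 + \<delta> * (\<theta> (j + 1) * \<theta> (j + 1))"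
        by (simp add: algebra_simps)
      also have "\<theta> (j + 1) * w ?x = \<bar>w ?x\<bar> * \<theta> j" using \<sigma>w[of ?x] by (simp add: \<theta>(3) mult_ac)
      also have "\<theta> (j + 1) * \<theta> (j + 1) = 1" by (rule \<theta>(1))
      finally show ?thesis by (simp add: u_def)
    qed
    ultimately show ?thesis by blast
  qed
  then show ?thesis using that \<delta> by blast
qed

section \<open>The characterization\<close>

text \<open>
  Lets both halves of condition (c) be treated as statements on windows that are read from left to
  right.
\<close>

lemma orbit_prod_backward: "\<bar>\<Prod>j=1..n. w (x - real j)\<bar> = orbit_prod w n (x - real n)"
proof -
  have "(\<Prod>j=1..n. w (x - real j)) = (\<Prod>i<n. w (x - real (Suc i)))"
    by (simp add: prod.atLeast1_atMost_eq)
  also have "\<dots> = (\<Prod>i<n. w (x - real n + real (n - Suc i)))"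
    by (intro prod.cong) (auto simp: of_nat_diff algebra_simps)
  also have "\<dots> = (\<Prod>i<n. w (x - real n + real i))"
    by (rule prod.nat_diff_reindex)
  finally show ?thesis by (simp add: orbit_prod_def)
qed

text \<open>
  The cutoffs for the three cases are the constants \<open>1\<close> and \<open>0\<close>, and a function that passes from \<open>1\<close> to
  \<open>0\<close> on the interval \<open>[0, 1]\<close>. The latter matches condition (c) exactly: a window of length \<open>n\<close> that
  starts at \<open>x\<close> and has \<open>x + n \<le> 1\<close> consists of points \<open>x, \<dots>, x + n - 1\<close> that are at most \<open>0\<close>, and
  windows that start to the right of \<open>0\<close> stay there.
\<close>

lemma shadowing_iff_exponential_bounds:
  fixes X :: "(real \<Rightarrow>\<^sub>C 'k::{real_normed_field,real_inner,banach}) set"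
  assumes X: "X \<in> {C0_R, Cb_R}"
    and uc: "uniformly_continuous_on UNIV w"
    and M: "\<And>x. \<bar>w x\<bar> \<le> M" and c: "0 < c" "\<And>x. c \<le> \<bar>w x\<bar>"
  shows "shadowing_property_on X (weighted_translation w) \<longleftrightarrow>
    (\<exists>C r. 0 < r \<and> r < 1 \<and> (\<forall>n. \<forall>x\<in>UNIV. orbit_prod w n x \<le> C * r ^ n)) \<or>
    (\<exists>C r. 0 < r \<and> r < 1 \<and> (\<forall>n. \<forall>x\<in>UNIV. 1 / orbit_prod w n x \<le> C * r ^ n)) \<or>
    (\<exists>C r. 0 < r \<and> r < 1 \<and> (\<forall>n. \<forall>x\<in>{..- real n + 1}. orbit_prod w n x \<le> C * r ^ n)) \<and>
    (\<exists>C r. 0 < r \<and> r < 1 \<and> (\<forall>n. \<forall>x\<in>{real n..}. 1 / orbit_prod w n (x - real n) \<le> C * r ^ n))"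
    (is "_ \<longleftrightarrow> ?A \<or> ?B \<or> (?C1 \<and> ?C2)")
proof
  have w: "continuous_on UNIV w" using uc by (rule uniformly_continuous_imp_continuous)
  assume sh: "shadowing_property_on X (weighted_translation w)"
  obtain \<delta> where \<delta>: "0 < \<delta>" "\<delta> < 1" and line:
    "\<And>s. \<exists>u :: int \<Rightarrow> real. \<forall>j. \<bar>u j\<bar> \<le> 1 \<and> u (j + 1) = \<bar>w (s - 1 - real_of_int j)\<bar> * u j + \<delta>"
    using line_solution_of_shadowing[OF X w M c sh] by blast
  define C r where "C = (M + 1) / \<delta>" and "r = 1 / (1 + \<delta>)"
  have r: "0 < r" "r < 1" using \<delta> by (auto simp: r_def)
  have left: "(\<forall>n (k::int). 1 / orbit_prod w n (s + k) \<le> C * r ^ n) \<or>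
         (\<exists>a. \<forall>n (k::int). s + k + real n \<le> a \<longrightarrow> orbit_prod w n (s + k) \<le> C * r ^ n)"
    and right: "(\<forall>n (k::int). orbit_prod w n (s + k) \<le> C * r ^ n) \<or>
         (\<exists>b. \<forall>n (k::int). b \<le> s + k \<longrightarrow> 1 / orbit_prod w n (s + k) \<le> C * r ^ n)" for s
  proof -
    obtain u :: "int \<Rightarrow> real" where u: "\<And>j. \<bar>u j\<bar> \<le> 1"
      "\<And>j. u (j + 1) = \<bar>w (s - 1 - real_of_int j)\<bar> * u j + \<delta>" using line[of s] by blast
    show "(\<forall>n (k::int). 1 / orbit_prod w n (s + k) \<le> C * r ^ n) \<or>
         (\<exists>a. \<forall>n (k::int). s + k + real n \<le> a \<longrightarrow> orbit_prod w n (s + k) \<le> C * r ^ n)"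
      unfolding C_def r_def by (rule line_dichotomy(1)[OF \<delta> c M u])
    show "(\<forall>n (k::int). orbit_prod w n (s + k) \<le> C * r ^ n) \<or>
         (\<exists>b. \<forall>n (k::int). b \<le> s + k \<longrightarrow> 1 / orbit_prod w n (s + k) \<le> C * r ^ n)"
      unfolding C_def r_def by (rule line_dichotomy(2)[OF \<delta> c M u])
  qed
  obtain r' where r': "0 < r'" "r' < 1" and
    "(\<forall>n x. orbit_prod w n x \<le> C * r' ^ n) \<or> (\<forall>n x. 1 / orbit_prod w n x \<le> C * r' ^ n) \<or>
     (\<exists>a b. (\<forall>n x. x + real n \<le> a \<longrightarrow> orbit_prod w n x \<le> C * r' ^ n) \<and>
            (\<forall>n x. b \<le> x \<longrightarrow> 1 / orbit_prod w n x \<le> C * r' ^ n))"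
    by (rule lines_to_global[OF uc c r left right])
  then consider (A) "\<forall>n x. orbit_prod w n x \<le> C * r' ^ n" | (B) "\<forall>n x. 1 / orbit_prod w n x \<le> C * r' ^ n"
    | (C) a b where "\<And>n x. x + real n \<le> a \<Longrightarrow> orbit_prod w n x \<le> C * r' ^ n"
       "\<And>n x. b \<le> x \<Longrightarrow> 1 / orbit_prod w n x \<le> C * r' ^ n" by blast
  then show "?A \<or> ?B \<or> (?C1 \<and> ?C2)"
  proof cases
    case A
    then show ?thesis using r' by blast
  next
    case B
    then show ?thesis using r' by blast
  next
    case C
    have ?C1 using extend_windows_left[OF M r' C(1)] r' by blast
    moreover have ?C2
    proof -
      have "\<bar>1 / w x\<bar> \<le> 1 / c" for x using c(2)[of x] c(1) by (simp add: frac_le)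
      from extend_windows_right[of "\<lambda>x. 1 / w x", OF this r', unfolded orbit_prod_inverse, OF C(2)]
      obtain C' where "\<And>n x. x \<in> {0..} \<Longrightarrow> 1 / orbit_prod w n x \<le> C' * r' ^ n" by blast
      then have "\<forall>n. \<forall>x\<in>{real n..}. 1 / orbit_prod w n (x - real n) \<le> C' * r' ^ n" by simp
      then show ?thesis using r' by blast
    qed
    ultimately show ?thesis by blast
  qed
next
  have w: "continuous_on UNIV w" using uc by (rule uniformly_continuous_imp_continuous)
  assume "?A \<or> ?B \<or> (?C1 \<and> ?C2)"
  then consider (A) ?A | (B) ?B | (C) "?C1 \<and> ?C2" by blast
  then show "shadowing_property_on X (weighted_translation w)"
  proof cases
    case A
    then obtain C r where r: "0 < r" "r < 1" "\<And>n x. orbit_prod w n x \<le> C * r ^ n" by blast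
    show ?thesis
      by (rule shadowing_of_cutoff[where \<kappa> = "\<lambda>_. 1", OF X w M c r(1,2)]) (use r(3) in auto)
  next
    case B
    then obtain C r where r: "0 < r" "r < 1" "\<And>n x. 1 / orbit_prod w n x \<le> C * r ^ n" by blast
    show ?thesis
      by (rule shadowing_of_cutoff[where \<kappa> = "\<lambda>_. 0", OF X w M c r(1,2)]) (use r(3) in auto)
  next
    case C
    then obtain C1 r1 where r1: "0 < r1" "r1 < 1"
      "\<And>n x. x \<in> {..- real n + 1} \<Longrightarrow> orbit_prod w n x \<le> C1 * r1 ^ n" by blast
    from C obtain C2 r2 where r2: "0 < r2" "r2 < 1"
      "\<And>n x. x \<in> {real n..} \<Longrightarrow> 1 / orbit_prod w n (x - real n) \<le> C2 * r2 ^ n" by blast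
    define r where "r = max r1 r2"
    define D where "D = max \<bar>C1\<bar> \<bar>C2\<bar>"
    have r: "0 < r" "r < 1" using r1 r2 by (auto simp: r_def)
    have bd: "C1 * r1 ^ n \<le> D * r ^ n" "C2 * r2 ^ n \<le> D * r ^ n" for n
      using r1 r2 r by (auto intro!: mult_mono power_mono simp: D_def r_def)
    show ?thesis
    proof (rule shadowing_of_cutoff[where \<kappa> = "\<lambda>x. max 0 (min 1 (1 - x))", OF X w M c r])
      show "continuous_on UNIV (\<lambda>x. max 0 (min 1 (1 - x)) :: real)" by (intro continuous_intros)
    next
      fix n x assume "max 0 (min 1 (1 - (x + real n))) \<noteq> 0"
      then have "x \<in> {..- real n + 1}" by (auto simp: max_def min_def split: if_splits)
      then show "orbit_prod w n x \<le> D * r ^ n" using r1(3) bd(1) order_trans by blast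
    next
      fix n and x :: real assume "max 0 (min 1 (1 - x)) \<noteq> 1"
      then have "x + real n \<in> {real n..}" by (auto simp: max_def min_def split: if_splits)
      from order_trans[OF r2(3)[OF this] bd(2)] show "1 / orbit_prod w n x \<le> D * r ^ n" by simp
    qed auto
  qed
qed

theorem corollary34:
  fixes w :: "real \<Rightarrow> real"
  assumes "uniformly_continuous_on UNIV w"
    and "0 < (INF x. \<bar>w x\<bar>)"
    and "bdd_above (range (\<lambda>x. \<bar>w x\<bar>))"
  shows
    "let a = (\<exists>L<1. (\<lambda>n. SUP x. root n \<bar>\<Prod>j<n. w (x + real j)\<bar>) \<longlonglongrightarrow> L);
         b = (\<exists>L>1. (\<lambda>n. INF x. root n \<bar>\<Prod>j<n. w (x + real j)\<bar>) \<longlonglongrightarrow> L);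
         c = ((\<exists>L<1. (\<lambda>n. SUP x\<in>{..- real n + 1}. root n \<bar>\<Prod>j<n. w (x + real j)\<bar>) \<longlonglongrightarrow> L) \<and>
              (\<exists>L>1. (\<lambda>n. INF x\<in>{real n..}. root n \<bar>\<Prod>j=1..n. w (x - real j)\<bar>) \<longlonglongrightarrow> L))
     in (\<forall>X \<in> {C0_R, Cb_R :: (real \<Rightarrow>\<^sub>C real) set}.
           invertible_operator_on X (weighted_translation w) \<and>
           (shadowing_property_on X (weighted_translation w) \<longleftrightarrow> a \<or> b \<or> c)) \<and>
        (\<forall>X \<in> {C0_R, Cb_R :: (real \<Rightarrow>\<^sub>C complex) set}.
           invertible_operator_on X (weighted_translation w) \<and>
           (shadowing_property_on X (weighted_translation w) \<longleftrightarrow> a \<or> b \<or> c))"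
proof -
  define c where "c = (INF x. \<bar>w x\<bar>)"
  define M where "M = (SUP x. \<bar>w x\<bar>)"
  have c: "0 < c" "\<And>x. c \<le> \<bar>w x\<bar>"
    using assms(2) unfolding c_def by (auto intro!: cINF_lower bdd_belowI2[where m = 0])
  have M: "\<bar>w x\<bar> \<le> M" for x
    using assms(3) unfolding M_def by (intro cSUP_upper) auto
  have w: "continuous_on UNIV w" using assms(1) by (rule uniformly_continuous_imp_continuous)
  note low = orbit_prod_ge_power[OF c] and up = orbit_prod_le_power[OF M]
  have a: "(\<exists>L<1. (\<lambda>n. SUP x. root n \<bar>\<Prod>j<n. w (x + real j)\<bar>) \<longlonglongrightarrow> L) \<longleftrightarrow>
      (\<exists>C r. 0 < r \<and> r < 1 \<and> (\<forall>n. \<forall>x\<in>UNIV. orbit_prod w n x \<le> C * r ^ n))"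
    unfolding orbit_prod_def[symmetric]
    by (rule exponential_bound_iff_limit_sup_root[OF _ c(1) low up]) (use orbit_prod_add in blast)+
  have b: "(\<exists>L>1. (\<lambda>n. INF x. root n \<bar>\<Prod>j<n. w (x + real j)\<bar>) \<longlonglongrightarrow> L) \<longleftrightarrow>
      (\<exists>C r. 0 < r \<and> r < 1 \<and> (\<forall>n. \<forall>x\<in>UNIV. 1 / orbit_prod w n x \<le> C * r ^ n))"
    unfolding orbit_prod_def[symmetric]
    by (rule exponential_bound_iff_limit_inf_root[OF _ c(1) low up]) (use orbit_prod_add in blast)+
  have c1: "(\<exists>L<1. (\<lambda>n. SUP x\<in>{..- real n + 1}. root n \<bar>\<Prod>j<n. w (x + real j)\<bar>) \<longlonglongrightarrow> L) \<longleftrightarrow>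
      (\<exists>C r. 0 < r \<and> r < 1 \<and> (\<forall>n. \<forall>x\<in>{..- real n + 1}. orbit_prod w n x \<le> C * r ^ n))"
    unfolding orbit_prod_def[symmetric]
  proof (rule exponential_bound_iff_limit_sup_root[OF _ c(1) low up])
    fix n m x assume "x \<in> {..- real (n + m) + 1}"
    then have "x \<in> {..- real n + 1}" "x + real n \<in> {..- real m + 1}" by auto
    then show "\<exists>y\<in>{..- real n + 1}. \<exists>z\<in>{..- real m + 1}.
        orbit_prod w (n + m) x = orbit_prod w n y * orbit_prod w m z"
      using orbit_prod_add by blast
  qed auto
  have c2: "(\<exists>L>1. (\<lambda>n. INF x\<in>{real n..}. root n \<bar>\<Prod>j=1..n. w (x - real j)\<bar>) \<longlonglongrightarrow> L) \<longleftrightarrow>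
      (\<exists>C r. 0 < r \<and> r < 1 \<and> (\<forall>n. \<forall>x\<in>{real n..}. 1 / orbit_prod w n (x - real n) \<le> C * r ^ n))"
    unfolding orbit_prod_backward
  proof (rule exponential_bound_iff_limit_inf_root[OF _ c(1) low up])
    fix n m x assume "x \<in> {real (n + m)..}"
    then have "x \<in> {real n..}" "x - real n \<in> {real m..}" by auto
    moreover have "orbit_prod w (n + m) (x - real (n + m)) =
        orbit_prod w n (x - real n) * orbit_prod w m (x - real n - real m)"
      using orbit_prod_add[of w m n "x - real (n + m)"] by (simp add: algebra_simps)
    ultimately show "\<exists>y\<in>{real n..}. \<exists>z\<in>{real m..}.
        orbit_prod w (n + m) (x - real (n + m)) = orbit_prod w n (y - real n) * orbit_prod w m (z - real m)"
      by blast
  qed auto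
  show ?thesis unfolding Let_def a b c1 c2
    by (intro conjI ballI;
        rule shadowing_iff_exponential_bounds[OF _ assms(1) M c] invertible_weighted_translation[OF _ w M c],
        assumption)
qed

end
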